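(* Let $P$ be a directed poset and $(\vec S_p\mid p\in P)$ an inverse system of finite separation systems with bonding homomorphisms $f_{qp}\colon\vec S_q\to\vec S_p$ ($p<q$), and let $\vec S=\varprojlim(\vec S_p\mid p\in P)$ be its inverse limit. Assume that $\vec S$ has no degenerate elements. Let $\mathcal F\subseteq 2^{\vec S}$ be a set of stars in $\vec S$ that is essentially closed in $2^{\vec S}$. If for every $p\in P$ the separation system $\vec S_p$ has a nested subset $\tau_p$ that is essentially over $\mathcal F_p$, then $\vec S$ has a nested subset $\tau$ that is closed in $\vec S$ and is over $\mathcal F$.
   Context: A separation system $(\vec S,\le,{}^* )$ is a poset with an order-reversing involution $\vec s\mapsto\overleftarrow s:=(\vec s)^*$. Its elements are oriented separations; $s=\{\vec s,\overleftarrow s\}$ is the underlying (unoriented) separation, and $S$ the set of these. $\vec s$ is degenerate if $\vec s=\overleftarrow s$, small if $\vec s\le\overleftarrow s$, co-small if $\overleftarrow s$ is small. $\vec r$ is trivial in $\vec S$ if there is $s\in S$ with $s\ne r$, $\vec r<\vec s$ and $\vec r<\overleftarrow s$ ($s$ is a witness). For a finite set $\sigma$ of oriented separations, $\vec r\in\sigma$ is trivial in $\sigma$ if it is trivial with a witness $s$ having an orientation in $\sigma$; $\sigma^-$ is $\sigma$ minus all its elements trivial in $\sigma$. Two separations are nested if they have comparable orientations; a set is nested if its elements are pairwise nested. A star is a set $\sigma$ of oriented separations with $\vec r\le\overleftarrow s$ for all distinct $\vec r,\vec s\in\sigma$. An orientation of a set of separations contains exactly one orientation of each of them; it is consistent if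 it contains no $\overleftarrow r,\vec s$ with $r\ne s$ and $\vec r<\vec s$. A pair $\{\overleftarrow s,\vec s'\}$ is inconsistent if $s\ne s'$ and $\vec s<\vec s'$. For a nested set $\tau$ of oriented separations, consider the separation system formed by $\tau$ and the inverses of its elements; a set $\sigma$ is a splitting star of $\tau$ if this system has a consistent orientation $O$ contained in the down-closure of $\sigma$ such that $\sigma$ is exactly the set of maximal elements of $O$. A homomorphism of separation systems is a map commuting with the involutions and with $\vec r\le\vec s\Rightarrow f(\vec r)\le f(\vec s)$. Inverse system: $f_{rp}=f_{qp}\circ f_{rq}$ for $p<q<r$. $\vec S$ consists of all families $(\vec s_p\mid p\in P)$ with $\vec s_p\in\vec S_p$ and $f_{qp}(\vec s_q)=\vec s_p$ for $p<q$; order and involution are componentwise; $\vec S$ carries the subspace topology of the product of the discrete spaces $\vec S_p$. Write $\vec s\restriction p:=\vec s_p$, $\sigma\restriction p:=\{\vec s\restriction p:\vec s\in\sigma\}$, $\vec S\restriction p$ the image of $\vec S$ in $\vec S_p$, $\mathcal F\restriction p:=\{\sigma\restriction p:\sigma\in\mathcal F\}$. $\vec r\in\vec S$ is finitely trivial if for every $p$ there is $q\ge p$ with $\vec r\restriction q$ trivial in $\vec S\restriction q$; $\overleftarrow r\in\vec S$ is finitely inconsistent if for every $p$ there is an inconsistent pair $\{\overleftarrow s,\vec s'\}\subseteq\vec S$ with $\overleftarrow s\restriction p=\overleftarrow r\restriction p=\vec s'\restriction p$. $\mathcal F$ is essentially closed in $2^{\vec S}$ if: (1) $\mathcal F$ contains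 every $\sigma\subseteq\vec S$ such that for every $p\in P$ there is $\tilde\sigma\in\mathcal F$ with either $(\tilde\sigma\restriction p)^-=(\sigma\restriction p)^-$, or $(\tilde\sigma\restriction p)^-=\{\vec s\restriction p,\overleftarrow s\restriction p\}$ and $\sigma=\{\vec s\}$; (2) $\mathcal F$ contains every $\{\overleftarrow r\}$ with $\overleftarrow r$ finitely inconsistent; (3) $\mathcal F$ contains every $\{\overleftarrow r\}$ with $\vec r$ finitely trivial. Let $\mathcal L_p$ be the set of all stars $\sigma\subseteq\vec S_p$ with $\sigma^-=\{\overleftarrow{r_p}\}$ for some $\overleftarrow{r_p}$ for which $\vec S$ has an inconsistent pair $\{\overleftarrow s,\vec s'\}$ with $\overleftarrow s\restriction p=\overleftarrow{r_p}=\vec s'\restriction p$, and $\mathcal F_p:=\mathcal F\restriction p\cup\mathcal L_p$. A nested $\tau_p\subseteq\vec S_p$ is essentially over $\mathcal F_p$ if for every splitting star $\sigma_p$ of $\tau_p$ there is $\sigma\in\mathcal F_p$ with either $\sigma_p=\sigma^-$, or $\sigma_p=\{\vec s\}$ and $\sigma^-=\{\vec s,\overleftarrow s\}$ for some $\vec s\in\vec S_p$. A nested $\tau\subseteq\vec S$ is over $\mathcal F$ if all its splitting stars lie in $\mathcal F$. *)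

theory Defs
  imports "HOL-Analysis.Analysis"
begin

record 'a sepsys =
  seps :: "'a set"
  sle :: "'a \<Rightarrow> 'a \<Rightarrow> bool"
  sinv :: "'a \<Rightarrow> 'a"

definition sep_system :: "'a sepsys \<Rightarrow> bool" where
  "sep_system X \<longleftrightarrow>
     reflp_on (seps X) (sle X) \<and> transp_on (seps X) (sle X) \<and> antisymp_on (seps X) (sle X) \<and>
     (\<forall>s\<in>seps X. sinv X s \<in> seps X \<and> sinv X (sinv X s) = s) \<and>
     (\<forall>r\<in>seps X. \<forall>s\<in>seps X. sle X r s \<longrightarrow> sle X (sinv X s) (sinv X r))"

definition slt :: "'a sepsys \<Rightarrow> 'a \<Rightarrow> 'a \<Rightarrow> bool" where
  "slt X r s \<longleftrightarrow> sle X r s \<and> r \<noteq> s"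

definition underlying :: "'a sepsys \<Rightarrow> 'a \<Rightarrow> 'a set" where
  "underlying X s = {s, sinv X s}"

definition degenerate :: "'a sepsys \<Rightarrow> 'a \<Rightarrow> bool" where
  "degenerate X s \<longleftrightarrow> s = sinv X s"

definition witnesses_triviality :: "'a sepsys \<Rightarrow> 'a \<Rightarrow> 'a \<Rightarrow> bool" where
  "witnesses_triviality X s r \<longleftrightarrow>
     underlying X s \<noteq> underlying X r \<and> slt X r s \<and> slt X r (sinv X s)"

definition trivial_in :: "'a sepsys \<Rightarrow> 'a \<Rightarrow> bool" where
  "trivial_in X r \<longleftrightarrow> r \<in> seps X \<and> (\<exists>s\<in>seps X. witnesses_triviality X s r)"

definition trivial_in_set :: "'a sepsys \<Rightarrow> 'a set \<Rightarrow> 'a \<Rightarrow> bool" where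
  "trivial_in_set X \<sigma> r \<longleftrightarrow>
     r \<in> \<sigma> \<and> (\<exists>s\<in>seps X. underlying X s \<inter> \<sigma> \<noteq> {} \<and> witnesses_triviality X s r)"

text \<open>The set \<open>core X \<sigma>\<close> is what is written \<open>\<sigma>\<close> with a superscript minus in the literature.\<close>

definition core :: "'a sepsys \<Rightarrow> 'a set \<Rightarrow> 'a set" where
  "core X \<sigma> = {r \<in> \<sigma>. \<not> trivial_in_set X \<sigma> r}"

definition nested_pair :: "'a sepsys \<Rightarrow> 'a \<Rightarrow> 'a \<Rightarrow> bool" where
  "nested_pair X r s \<longleftrightarrow>
     (\<exists>a\<in>underlying X r. \<exists>b\<in>underlying X s. sle X a b \<or> sle X b a)"

definition nested :: "'a sepsys \<Rightarrow> 'a set \<Rightarrow> bool" where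
  "nested X \<tau> \<longleftrightarrow> (\<forall>r\<in>\<tau>. \<forall>s\<in>\<tau>. nested_pair X r s)"

definition star :: "'a sepsys \<Rightarrow> 'a set \<Rightarrow> bool" where
  "star X \<sigma> \<longleftrightarrow> \<sigma> \<subseteq> seps X \<and> (\<forall>r\<in>\<sigma>. \<forall>s\<in>\<sigma>. r \<noteq> s \<longrightarrow> sle X r (sinv X s))"

definition orientation :: "'a sepsys \<Rightarrow> 'a set \<Rightarrow> bool" where
  "orientation X O' \<longleftrightarrow>
     O' \<subseteq> seps X \<and> (\<forall>s\<in>seps X. \<exists>!x. x \<in> underlying X s \<and> x \<in> O')"

text \<open>The arguments \<open>x\<close> and \<open>y\<close> are the two elements of the pair; for the inverse \<open>s\<close> of \<open>x\<close>,
  the requirement is that \<open>s\<close> and \<open>y\<close> have distinct underlying separations and \<open>s < y\<close>.\<close>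

definition inconsistent_pair :: "'a sepsys \<Rightarrow> 'a \<Rightarrow> 'a \<Rightarrow> bool" where
  "inconsistent_pair X x y \<longleftrightarrow>
     x \<in> seps X \<and> y \<in> seps X \<and> underlying X (sinv X x) \<noteq> underlying X y \<and> slt X (sinv X x) y"

definition consistent :: "'a sepsys \<Rightarrow> 'a set \<Rightarrow> bool" where
  "consistent X O' \<longleftrightarrow> \<not> (\<exists>x\<in>O'. \<exists>y\<in>O'. inconsistent_pair X x y)"

definition down_closure :: "'a sepsys \<Rightarrow> 'a set \<Rightarrow> 'a set" where
  "down_closure X \<sigma> = {r \<in> seps X. \<exists>s\<in>\<sigma>. sle X r s}"

definition maximal_elements :: "'a sepsys \<Rightarrow> 'a set \<Rightarrow> 'a set" where
  "maximal_elements X A = {x \<in> A. \<not> (\<exists>y\<in>A. slt X x y)}"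

definition subsystem :: "'a sepsys \<Rightarrow> 'a set \<Rightarrow> 'a sepsys" where
  "subsystem X \<tau> = X\<lparr>seps := \<tau> \<union> sinv X ` \<tau>\<rparr>"

definition splitting_star :: "'a sepsys \<Rightarrow> 'a set \<Rightarrow> 'a set \<Rightarrow> bool" where
  "splitting_star X \<tau> \<sigma> \<longleftrightarrow>
     (\<exists>O'. orientation (subsystem X \<tau>) O' \<and> consistent (subsystem X \<tau>) O' \<and>
           O' \<subseteq> down_closure (subsystem X \<tau>) \<sigma> \<and>
           \<sigma> = maximal_elements (subsystem X \<tau>) O')"

definition sep_hom :: "'a sepsys \<Rightarrow> 'b sepsys \<Rightarrow> ('a \<Rightarrow> 'b) \<Rightarrow> bool" where
  "sep_hom X Y f \<longleftrightarrow>
     (\<forall>s\<in>seps X. f s \<in> seps Y \<and> f (sinv X s) = sinv Y (f s)) \<and>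
     (\<forall>r\<in>seps X. \<forall>s\<in>seps X. sle X r s \<longrightarrow> sle Y (f r) (f s))"

text \<open>The bonding map from level \<open>q\<close> to level \<open>p\<close>, for \<open>p < q\<close>, is \<open>f q p\<close>.\<close>

definition inverse_system ::
    "('p::order \<Rightarrow> 'a sepsys) \<Rightarrow> ('p \<Rightarrow> 'p \<Rightarrow> 'a \<Rightarrow> 'a) \<Rightarrow> bool" where
  "inverse_system S f \<longleftrightarrow>
     (\<forall>p. sep_system (S p)) \<and>
     (\<forall>p q. p < q \<longrightarrow> sep_hom (S q) (S p) (f q p)) \<and>
     (\<forall>p q r. p < q \<longrightarrow> q < r \<longrightarrow> (\<forall>s\<in>seps (S r). f r p s = f q p (f r q s)))"

definition inv_limit ::
    "('p::order \<Rightarrow> 'a sepsys) \<Rightarrow> ('p \<Rightarrow> 'p \<Rightarrow> 'a \<Rightarrow> 'a) \<Rightarrow> ('p \<Rightarrow> 'a) sepsys" where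
  "inv_limit S f =
     \<lparr>seps = {s. (\<forall>p. s p \<in> seps (S p)) \<and> (\<forall>p q. p < q \<longrightarrow> f q p (s q) = s p)},
      sle = (\<lambda>r s. \<forall>p. sle (S p) (r p) (s p)),
      sinv = (\<lambda>s p. sinv (S p) (s p))\<rparr>"

definition limit_topology ::
    "('p::order \<Rightarrow> 'a sepsys) \<Rightarrow> ('p \<Rightarrow> 'p \<Rightarrow> 'a \<Rightarrow> 'a) \<Rightarrow> ('p \<Rightarrow> 'a) topology" where
  "limit_topology S f =
     subtopology (product_topology (\<lambda>p. discrete_topology (seps (S p))) UNIV)
       (seps (inv_limit S f))"

definition proj :: "'p \<Rightarrow> ('p \<Rightarrow> 'a) set \<Rightarrow> 'a set" where
  "proj p \<sigma> = (\<lambda>s. s p) ` \<sigma>"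

definition image_system ::
    "('p::order \<Rightarrow> 'a sepsys) \<Rightarrow> ('p \<Rightarrow> 'p \<Rightarrow> 'a \<Rightarrow> 'a) \<Rightarrow> 'p \<Rightarrow> 'a sepsys" where
  "image_system S f p = (S p)\<lparr>seps := proj p (seps (inv_limit S f))\<rparr>"

definition finitely_trivial ::
    "('p::order \<Rightarrow> 'a sepsys) \<Rightarrow> ('p \<Rightarrow> 'p \<Rightarrow> 'a \<Rightarrow> 'a) \<Rightarrow> ('p \<Rightarrow> 'a) \<Rightarrow> bool" where
  "finitely_trivial S f r \<longleftrightarrow>
     r \<in> seps (inv_limit S f) \<and> (\<forall>p. \<exists>q\<ge>p. trivial_in (image_system S f q) (r q))"

definition has_inconsistent_pair_over ::
    "('p::order \<Rightarrow> 'a sepsys) \<Rightarrow> ('p \<Rightarrow> 'p \<Rightarrow> 'a \<Rightarrow> 'a) \<Rightarrow> 'p \<Rightarrow> 'a \<Rightarrow> bool" where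
  "has_inconsistent_pair_over S f p a \<longleftrightarrow>
     (\<exists>x y. inconsistent_pair (inv_limit S f) x y \<and> x p = a \<and> y p = a)"

definition finitely_inconsistent ::
    "('p::order \<Rightarrow> 'a sepsys) \<Rightarrow> ('p \<Rightarrow> 'p \<Rightarrow> 'a \<Rightarrow> 'a) \<Rightarrow> ('p \<Rightarrow> 'a) \<Rightarrow> bool" where
  "finitely_inconsistent S f x \<longleftrightarrow>
     x \<in> seps (inv_limit S f) \<and> (\<forall>p. has_inconsistent_pair_over S f p (x p))"

definition essentially_closed ::
    "('p::order \<Rightarrow> 'a sepsys) \<Rightarrow> ('p \<Rightarrow> 'p \<Rightarrow> 'a \<Rightarrow> 'a) \<Rightarrow> ('p \<Rightarrow> 'a) set set \<Rightarrow> bool" where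
  "essentially_closed S f F \<longleftrightarrow>
     (\<forall>\<sigma>. \<sigma> \<subseteq> seps (inv_limit S f) \<longrightarrow>
        (\<forall>p. \<exists>\<sigma>'\<in>F. core (S p) (proj p \<sigma>') = core (S p) (proj p \<sigma>) \<or>
           (\<exists>s. core (S p) (proj p \<sigma>') = {s p, sinv (inv_limit S f) s p} \<and> \<sigma> = {s})) \<longrightarrow>
        \<sigma> \<in> F) \<and>
     (\<forall>x. finitely_inconsistent S f x \<longrightarrow> {x} \<in> F) \<and>
     (\<forall>r. finitely_trivial S f r \<longrightarrow> {sinv (inv_limit S f) r} \<in> F)"

definition level_L ::
    "('p::order \<Rightarrow> 'a sepsys) \<Rightarrow> ('p \<Rightarrow> 'p \<Rightarrow> 'a \<Rightarrow> 'a) \<Rightarrow> 'p \<Rightarrow> 'a set set" where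
  "level_L S f p =
     {\<sigma>. star (S p) \<sigma> \<and> (\<exists>a. core (S p) \<sigma> = {a} \<and> has_inconsistent_pair_over S f p a)}"

definition level_F ::
    "('p::order \<Rightarrow> 'a sepsys) \<Rightarrow> ('p \<Rightarrow> 'p \<Rightarrow> 'a \<Rightarrow> 'a) \<Rightarrow> ('p \<Rightarrow> 'a) set set \<Rightarrow> 'p \<Rightarrow> 'a set set" where
  "level_F S f F p = proj p ` F \<union> level_L S f p"

definition essentially_over :: "'a sepsys \<Rightarrow> 'a set \<Rightarrow> 'a set set \<Rightarrow> bool" where
  "essentially_over X \<tau> G \<longleftrightarrow>
     (\<forall>\<sigma>'. splitting_star X \<tau> \<sigma>' \<longrightarrow>
        (\<exists>\<sigma>\<in>G. \<sigma>' = core X \<sigma> \<or> (\<exists>s\<in>seps X. \<sigma>' = {s} \<and> core X \<sigma> = {s, sinv X s})))"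

definition over :: "'a sepsys \<Rightarrow> 'a set \<Rightarrow> 'a set set \<Rightarrow> bool" where
  "over X \<tau> F \<longleftrightarrow> (\<forall>\<sigma>. splitting_star X \<tau> \<sigma> \<longrightarrow> \<sigma> \<in> F)"

end

theory Submission
  imports Defs
begin

text \<open>Essentially over \<open>F\<^sub>p\<close> is inherited by images under the bonding maps, so a compactness
  argument yields compatible nested sets \<open>N p\<close>, whose limit \<open>T\<close> is closed and nested. Let \<open>\<sigma>\<close> be the
  set of maximal elements of a consistent orientation \<open>Q\<close> of \<open>T\<close> with \<open>Q\<close> in the down-closure of \<open>\<sigma>\<close>.

  If \<open>\<sigma>\<close> has a co-small element \<open>x\<close>, then \<open>\<sigma> = {x}\<close>. Either the inverse of \<open>x\<close> is finitely trivial, or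
  at all large levels orienting everything towards \<open>x p\<close> gives a splitting star \<open>{x p}\<close> of \<open>N p\<close>.

  Otherwise \<open>Q\<close> turns out to be topologically closed, so at all large levels it projects to a
  consistent orientation of \<open>N p\<close>, whose splitting star is the core of the projection of \<open>\<sigma>\<close>. Passing
  down to a small level \<open>p\<close> preserves the core, except when some \<open>x \<in> \<sigma>\<close> becomes co-small at \<open>p\<close>;
  compactness then provides a trivial \<open>y\<close> in the limit that agrees at \<open>p\<close> with the inverse of \<open>x\<close>,
  and the singleton of the inverse of \<open>y\<close> does the job.\<close>

section \<open>Limits of finite sets and separation systems\<close>

text \<open>By Tychonoff the product of the finite discrete sets \<open>A p\<close> is compact. Each
  single compatibility condition cuts out a closed set, being the equalizer of two continuous maps
  into a Hausdorff space, and by directedness any finitely many conditions can be met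
  together.\<close>

lemma finite_inverse_limit_nonempty:
  fixes A :: "'p::order \<Rightarrow> 'b set" and g :: "'p \<Rightarrow> 'p \<Rightarrow> 'b \<Rightarrow> 'b"
  assumes directed: "\<And>p q :: 'p. \<exists>r. p \<le> r \<and> q \<le> r"
    and fin: "\<And>p. finite (A p)" and ne: "\<And>p. A p \<noteq> {}"
    and maps: "\<And>p q x. p < q \<Longrightarrow> x \<in> A q \<Longrightarrow> g q p x \<in> A p"
    and comp: "\<And>p q r x. p < q \<Longrightarrow> q < r \<Longrightarrow> x \<in> A r \<Longrightarrow> g r p x = g q p (g r q x)"
  shows "\<exists>x. (\<forall>p. x p \<in> A p) \<and> (\<forall>p q. p < q \<longrightarrow> g q p (x q) = x p)"
proof -
  define X where "X = product_topology (\<lambda>p. discrete_topology (A p)) UNIV"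
  define C where "C = (\<lambda>(p, q). {x \<in> topspace X. g q p (x q) = x p})"
  let ?I = "{(p :: 'p, q :: 'p). p < q}"
  have top: "topspace X = (\<Pi>\<^sub>E p\<in>UNIV. A p)"
    by (simp add: X_def)
  have cpt: "compact_space X"
    by (simp add: X_def compact_space_product_topology compact_space_discrete_topology fin)
  have proj: "continuous_map X (discrete_topology (A p)) (\<lambda>x. x p)" for p
    unfolding X_def by (rule continuous_map_product_projection) simp
  have cl: "closedin X (C i)" if i: "i \<in> ?I" for i
  proof -
    obtain p q where pq: "i = (p, q)" "p < q"
      using i by auto
    have "continuous_map (discrete_topology (A q)) (discrete_topology (A p)) (g q p)"
      using maps[OF pq(2)] by auto
    then have "continuous_map X (discrete_topology (A p)) (g q p \<circ> (\<lambda>x. x q))"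
      using proj continuous_map_compose by blast
    then show ?thesis
      using closedin_continuous_maps_eq[OF _ _ proj[of p], of "g q p \<circ> (\<lambda>x. x q)"]
      by (simp add: C_def pq Hausdorff_space_discrete_topology)
  qed
  \<comment> \<open>The whole space is added to the family so that a point of its intersection lies
    in the product even when there is no pair \<open>p < q\<close>.\<close>
  have fip: "\<Inter>\<F> \<noteq> {}" if F: "finite \<F>" "\<F> \<subseteq> insert (topspace X) (C ` ?I)" for \<F>
  proof -
    have "finite (\<F> - {topspace X})" "\<F> - {topspace X} \<subseteq> C ` ?I"
      using F by auto
    then obtain J where J: "J \<subseteq> ?I" "finite J" "\<F> - {topspace X} = C ` J"
      using finite_subset_image by metis
    have "\<exists>r. \<forall>i\<in>J. snd i \<le> r"
      using J(2)
    proof (induction J rule: finite_induct)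
      case (insert i J)
      then obtain r where "\<forall>i\<in>J. snd i \<le> r" by blast
      moreover obtain r' where "r \<le> r'" "snd i \<le> r'"
        using directed by blast
      ultimately have "\<forall>j\<in>insert i J. snd j \<le> r'"
        by force
      then show ?case by blast
    qed simp
    then obtain r where r: "\<And>p q. (p, q) \<in> J \<Longrightarrow> q \<le> r"
      by fastforce
    obtain a where a: "a \<in> A r" using ne by blast
    \<comment> \<open>The finitely many conditions in \<open>J\<close> only concern indices below
      \<open>r\<close>, where pushing \<open>a\<close> down satisfies them; the values elsewhere are
      arbitrary.\<close>
    define x where
      "x = (\<lambda>p. if p = r then a else if p < r then g r p a else SOME b. b \<in> A p)"
    have xA: "x p \<in> A p" for p
      using a maps ne by (auto simp: x_def some_in_eq)
    have "x \<in> topspace X"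
      using xA by (auto simp: top)
    moreover have "g q p (x q) = x p" if "(p, q) \<in> J" for p q
    proof -
      have "p < q" "q \<le> r" using that J r by auto
      then show ?thesis using comp[OF _ _ a, of p q]
        by (cases "q = r") (auto simp: x_def)
    qed
    ultimately have "x \<in> D" if "D \<in> insert (topspace X) (C ` J)" for D
      using that by (auto simp: C_def)
    moreover have "\<F> \<subseteq> insert (topspace X) (C ` J)"
      using J(3) by (metis Diff_subset_conv insert_is_Un order_refl)
    ultimately have "x \<in> \<Inter>\<F>"
      by (meson InterI subsetD)
    then show ?thesis by blast
  qed
  have "\<Inter>(insert (topspace X) (C ` ?I)) \<noteq> {}"
  proof -
    have "closedin X D" if "D \<in> insert (topspace X) (C ` ?I)" for D
      using that cl by blast
    then show ?thesis
      using cpt[unfolded compact_space_fip, rule_format, of "insert (topspace X) (C ` ?I)"] fip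
      by meson
  qed
  then obtain x where x: "x \<in> \<Inter>(insert (topspace X) (C ` ?I))"
    by (metis ex_in_conv)
  then have "x \<in> topspace X" by simp
  moreover have "x \<in> C (p, q)" if "p < q" for p q
    using x that by simp
  ultimately have "\<forall>p. x p \<in> A p" "\<forall>p q. p < q \<longrightarrow> g q p (x q) = x p"
    by (simp_all add: top C_def PiE_iff)
  then show ?thesis by blast
qed

section \<open>Separation systems: stars, their cores and maximal elements\<close>

locale separation_system =
  fixes X :: "'a sepsys"
  assumes sep_system: "sep_system X"
begin

abbreviation le (infix "\<preceq>" 50) where "a \<preceq> b \<equiv> sle X a b"
abbreviation inv where "inv \<equiv> sinv X"

lemma refl: "a \<in> seps X \<Longrightarrow> a \<preceq> a"
  using sep_system unfolding sep_system_def by (blast dest: reflp_onD)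

lemma trans: "a \<preceq> b \<Longrightarrow> b \<preceq> c \<Longrightarrow> a \<in> seps X \<Longrightarrow> b \<in> seps X \<Longrightarrow> c \<in> seps X \<Longrightarrow> a \<preceq> c"
  using sep_system unfolding sep_system_def by (blast dest: transp_onD)

lemma antisym: "a \<preceq> b \<Longrightarrow> b \<preceq> a \<Longrightarrow> a \<in> seps X \<Longrightarrow> b \<in> seps X \<Longrightarrow> a = b"
  using sep_system unfolding sep_system_def by (blast dest: antisymp_onD)

lemma inv_closed [simp]: "a \<in> seps X \<Longrightarrow> inv a \<in> seps X"
  using sep_system unfolding sep_system_def by blast

lemma inv_inv [simp]: "a \<in> seps X \<Longrightarrow> inv (inv a) = a"
  using sep_system unfolding sep_system_def by blast

lemma inv_mono: "a \<preceq> b \<Longrightarrow> a \<in> seps X \<Longrightarrow> b \<in> seps X \<Longrightarrow> inv b \<preceq> inv a"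
  using sep_system unfolding sep_system_def by blast

lemma inv_le_inv [simp]: "a \<in> seps X \<Longrightarrow> b \<in> seps X \<Longrightarrow> inv a \<preceq> inv b \<longleftrightarrow> b \<preceq> a"
  using inv_mono inv_closed inv_inv by metis

lemma le_inv_swap: "a \<in> seps X \<Longrightarrow> b \<in> seps X \<Longrightarrow> a \<preceq> inv b \<longleftrightarrow> b \<preceq> inv a"
  using inv_le_inv inv_closed inv_inv by metis

lemma inv_le_swap: "a \<in> seps X \<Longrightarrow> b \<in> seps X \<Longrightarrow> inv a \<preceq> b \<longleftrightarrow> inv b \<preceq> a"
  using inv_le_inv inv_closed inv_inv by metis

lemma underlying_eq_iff:
  "a \<in> seps X \<Longrightarrow> b \<in> seps X \<Longrightarrow> underlying X a = underlying X b \<longleftrightarrow> a = b \<or> a = inv b"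
  unfolding underlying_def doubleton_eq_iff using inv_inv by metis

lemma mem_maximal_elements:
  "x \<in> maximal_elements X A \<longleftrightarrow> x \<in> A \<and> (\<forall>y\<in>A. x \<preceq> y \<longrightarrow> x = y)"
  unfolding maximal_elements_def slt_def by auto

lemma ex_maximal_above:
  assumes "finite A" "A \<subseteq> seps X" "a \<in> A"
  shows "\<exists>c\<in>maximal_elements X A. a \<preceq> c"
proof -
  let ?B = "{b \<in> A. a \<preceq> b}"
  have "asymp_on ?B (slt X)"
    using assms(2) antisym unfolding slt_def asymp_on_def by blast
  moreover have "transp_on ?B (slt X)"
  proof (rule transp_onI)
    fix b c d
    assume h: "b \<in> ?B" "c \<in> ?B" "d \<in> ?B" "slt X b c" "slt X c d"
    then have "b \<in> seps X" "c \<in> seps X" "d \<in> seps X" using assms(2) by auto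
    then show "slt X b d" using h(4,5) trans antisym unfolding slt_def by metis
  qed
  moreover have "?B \<noteq> {}" "finite ?B"
    using assms refl by auto
  ultimately obtain m where m: "m \<in> ?B" "\<forall>x\<in>?B. x \<noteq> m \<longrightarrow> \<not> slt X m x"
    using Finite_Set.bex_max_element[of ?B "slt X"] by blast
  have "m \<in> maximal_elements X A"
    unfolding mem_maximal_elements
  proof (intro conjI ballI impI)
    fix y assume y: "y \<in> A" "m \<preceq> y"
    then have "a \<preceq> y" using trans[of a m y] m(1) assms by blast
    then show "m = y" using m(2) y unfolding slt_def by auto
  qed (use m in blast)
  then show ?thesis using m by blast
qed

lemma starD: "star X \<sigma> \<Longrightarrow> a \<in> \<sigma> \<Longrightarrow> b \<in> \<sigma> \<Longrightarrow> a \<noteq> b \<Longrightarrow> a \<preceq> inv b"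
  unfolding star_def by blast

lemma star_subset: "star X \<sigma> \<Longrightarrow> \<sigma> \<subseteq> seps X"
  unfolding star_def by blast

lemma core_subset: "core X \<sigma> \<subseteq> \<sigma>"
  unfolding core_def by blast

text \<open>The conditions on a witness are invariant under inverting it, so the orientation lying
  in \<sigma> can be taken as the witness.\<close>

lemma trivial_in_set_iff:
  assumes "\<sigma> \<subseteq> seps X"
  shows "trivial_in_set X \<sigma> r \<longleftrightarrow>
    r \<in> \<sigma> \<and> (\<exists>s\<in>\<sigma>. s \<noteq> r \<and> s \<noteq> inv r \<and> r \<preceq> s \<and> r \<preceq> inv s)" (is "_ \<longleftrightarrow> ?R")
proof
  assume "trivial_in_set X \<sigma> r"
  then obtain s where s: "r \<in> \<sigma>" "s \<in> seps X" "s \<in> \<sigma> \<or> inv s \<in> \<sigma>"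
      "underlying X s \<noteq> underlying X r" "r \<preceq> s" "r \<preceq> inv s"
    unfolding trivial_in_set_def witnesses_triviality_def slt_def underlying_def by blast
  have "r \<in> seps X" using s assms by blast
  show ?R
    using s(3)
  proof
    assume "s \<in> \<sigma>"
    then show ?R using s \<open>r \<in> seps X\<close> underlying_eq_iff by blast
  next
    assume "inv s \<in> \<sigma>"
    then show ?R using s \<open>r \<in> seps X\<close> underlying_eq_iff[of s r] by (metis inv_inv)
  qed
next
  assume ?R
  then show "trivial_in_set X \<sigma> r"
    using assms underlying_eq_iff
    unfolding trivial_in_set_def witnesses_triviality_def slt_def
    by (smt (verit, best) inv_inv disjoint_iff insertI1 subset_eq underlying_def)
qed

text \<open>All other elements of the star lie below the inverse of \<open>z\<close>, hence also
  below \<open>z\<close>. So \<open>z\<close> witnesses the triviality of every element except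
  \<open>z\<close> and its inverse, which have the same underlying separation as
  \<open>z\<close>.\<close>

lemma core_with_cosmall:
  assumes st: "star X \<sigma>" and z: "z \<in> \<sigma>" "inv z \<preceq> z"
  shows "core X \<sigma> = insert z ({inv z} \<inter> \<sigma>)"
proof -
  have sub: "\<sigma> \<subseteq> seps X" using st by (rule star_subset)
  have below: "v \<preceq> inv z" "v \<preceq> z" if "v \<in> \<sigma>" "v \<noteq> z" for v
  proof -
    show "v \<preceq> inv z" using starD st that z by blast
    then show "v \<preceq> z" using trans z sub that by (meson inv_closed subsetD)
  qed
  have "trivial_in_set X \<sigma> v" if "v \<in> \<sigma>" "v \<noteq> z" "v \<noteq> inv z" for v
    unfolding trivial_in_set_iff[OF sub] using below that z(1)
    by (metis inv_inv subsetD sub)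
  moreover have "\<not> trivial_in_set X \<sigma> z"
    unfolding trivial_in_set_iff[OF sub] using below antisym z sub by (metis subsetD)
  moreover have "\<not> trivial_in_set X \<sigma> (inv z)" if "inv z \<in> \<sigma>"
    unfolding trivial_in_set_iff[OF sub]
    using below antisym z sub by (metis inv_closed inv_inv subsetD)
  ultimately show ?thesis
    using z(1) by (auto simp: core_def)
qed

text \<open>In a star \<open>r\<close> lies below the inverse of every other element
  \<open>s\<close> anyway, so only \<open>r < s\<close> matters for triviality. The remaining
  requirement that \<open>s\<close> is not the inverse of \<open>r\<close> is automatic, since
  \<open>r \<preceq> s\<close> would then make \<open>s\<close> co-small.\<close>

lemma core_without_cosmall:
  assumes st: "star X \<sigma>" and nc: "\<And>z. z \<in> \<sigma> \<Longrightarrow> \<not> inv z \<preceq> z"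
  shows "core X \<sigma> = maximal_elements X \<sigma>"
proof -
  have sub: "\<sigma> \<subseteq> seps X" using st by (rule star_subset)
  have "trivial_in_set X \<sigma> r \<longleftrightarrow> (\<exists>s\<in>\<sigma>. r \<preceq> s \<and> r \<noteq> s)" if r: "r \<in> \<sigma>" for r
    unfolding trivial_in_set_iff[OF sub]
    using r starD[OF st r] nc sub by (metis inv_inv subsetD)
  then show ?thesis
    unfolding set_eq_iff mem_maximal_elements by (auto simp: core_def)
qed

lemma core_singleton [simp]: "a \<in> seps X \<Longrightarrow> core X {a} = {a}"
  unfolding core_def using trivial_in_set_iff[of "{a}"] by blast

lemma star_singleton [simp]: "star X {a} \<longleftrightarrow> a \<in> seps X"
  by (auto simp: star_def)

text \<open>A co-small element of a star is above the whole star and belongs to the core; without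
  one, the core consists of the maximal elements and finiteness applies.\<close>

lemma ex_core_above:
  assumes st: "star X \<sigma>" and fin: "finite \<sigma>" and v: "v \<in> \<sigma>"
  shows "\<exists>c\<in>core X \<sigma>. v \<preceq> c"
proof (cases "\<exists>z\<in>\<sigma>. inv z \<preceq> z")
  case True
  then obtain z where z: "z \<in> \<sigma>" "inv z \<preceq> z" by blast
  have "v \<preceq> z"
  proof (cases "v = z")
    case True
    then show ?thesis using v refl star_subset[OF st] by blast
  next
    case False
    then have "v \<preceq> inv z" using starD st v z by blast
    then show ?thesis using trans[OF _ z(2)] v z star_subset[OF st]
      by (meson inv_closed subsetD)
  qed
  then show ?thesis using core_with_cosmall[OF st z] by blast
next
  case False
  then show ?thesis
    using core_without_cosmall[OF st] ex_maximal_above[OF fin star_subset[OF st] v] by auto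
qed

end

lemma seps_subsystem [simp]: "seps (subsystem X T) = T \<union> sinv X ` T"
  and sle_subsystem [simp]: "sle (subsystem X T) = sle X"
  and sinv_subsystem [simp]: "sinv (subsystem X T) = sinv X"
  by (simp_all add: subsystem_def)

section \<open>Splitting stars of nested sets\<close>

context separation_system
begin

definition sym_subset :: "'a set \<Rightarrow> bool" where
  "sym_subset T \<longleftrightarrow> T \<subseteq> seps X \<and> inv ` T \<subseteq> T"

text \<open>A working form of splitting stars that keeps the orientation \<open>Q\<close> visible,
  meant for sets closed under inversion and without degenerate elements. The consistency clause
  allows \<open>r = s\<close>, because a single co-small element is not an inconsistent
  pair.\<close>

definition splits :: "'a set \<Rightarrow> 'a set \<Rightarrow> 'a set \<Rightarrow> bool" where
  "splits T Q \<sigma> \<longleftrightarrow>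
     Q \<subseteq> T \<and> (\<forall>x\<in>T. x \<in> Q \<longleftrightarrow> inv x \<notin> Q) \<and> (\<forall>r\<in>Q. \<forall>s\<in>Q. inv r \<preceq> s \<longrightarrow> r = s) \<and>
     (\<forall>x\<in>Q. \<exists>s\<in>\<sigma>. x \<preceq> s) \<and> \<sigma> = maximal_elements X Q"

lemma cosmall_mono:
  "inv a \<preceq> a \<Longrightarrow> a \<preceq> b \<Longrightarrow> a \<in> seps X \<Longrightarrow> b \<in> seps X \<Longrightarrow> inv b \<preceq> b"
  using inv_mono trans inv_closed by meson

lemma splitting_star_symmetrize: "splitting_star X (T \<union> inv ` T) = splitting_star X T"
  if "T \<subseteq> seps X"
proof -
  have "inv ` inv ` T = T"
    using that by (force simp: image_image image_iff)
  then have "subsystem X (T \<union> inv ` T) = subsystem X T"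
    by (simp add: subsystem_def image_Un Un_ac)
  then show ?thesis
    unfolding fun_eq_iff splitting_star_def by simp
qed

text \<open>An orientation without degenerate elements never contains both \<open>r\<close> and its
  inverse. For elements \<open>r\<close>, \<open>s\<close> of it, both the strictness of the
  inequality and the distinctness of the underlying separations therefore amount to
  \<open>r \<noteq> s\<close>.\<close>

lemma splitting_star_iff:
  assumes T: "sym_subset T" and nd: "\<And>x. x \<in> T \<Longrightarrow> inv x \<noteq> x"
  shows "splitting_star X T \<sigma> \<longleftrightarrow> (\<exists>Q. splits T Q \<sigma>)"
proof -
  have sub: "T \<subseteq> seps X" and Tinv: "T \<union> inv ` T = T"
    using T unfolding sym_subset_def by auto
  have ori: "orientation (subsystem X T) Q \<longleftrightarrow> Q \<subseteq> T \<and> (\<forall>x\<in>T. x \<in> Q \<longleftrightarrow> inv x \<notin> Q)" for Q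
    unfolding orientation_def underlying_def sinv_subsystem seps_subsystem Tinv
    using nd by (intro conj_cong ball_cong refl) auto
  have con: "consistent (subsystem X T) Q \<longleftrightarrow> (\<forall>r\<in>Q. \<forall>s\<in>Q. inv r \<preceq> s \<longrightarrow> r = s)"
    if Q: "Q \<subseteq> T" "\<forall>x\<in>T. x \<in> Q \<longleftrightarrow> inv x \<notin> Q" for Q
  proof -
    have "inconsistent_pair (subsystem X T) r s \<longleftrightarrow> inv r \<preceq> s \<and> r \<noteq> s" if "r \<in> Q" "s \<in> Q" for r s
    proof -
      have "r \<in> T" "s \<in> T" "r \<in> seps X" "s \<in> seps X" using that Q sub by auto
      moreover have "inv r \<noteq> s" using that Q \<open>r \<in> T\<close> by auto
      moreover have "underlying (subsystem X T) = underlying X"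
        by (simp add: underlying_def fun_eq_iff)
      moreover have "inv r = inv s \<longleftrightarrow> r = s"
        using \<open>r \<in> seps X\<close> \<open>s \<in> seps X\<close> inv_inv by metis
      ultimately show ?thesis
        unfolding inconsistent_pair_def slt_def sinv_subsystem sle_subsystem seps_subsystem Tinv
        using underlying_eq_iff[of "inv r" s] by auto
    qed
    then show ?thesis unfolding consistent_def by blast
  qed
  have dn: "Q \<subseteq> down_closure (subsystem X T) \<sigma> \<longleftrightarrow> (\<forall>x\<in>Q. \<exists>s\<in>\<sigma>. x \<preceq> s)" if "Q \<subseteq> T" for Q
    using that Tinv unfolding down_closure_def by auto
  have mx: "maximal_elements (subsystem X T) Q = maximal_elements X Q" for Q
    by (simp add: maximal_elements_def slt_def)
  have "orientation (subsystem X T) Q \<and> consistent (subsystem X T) Q \<and>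
      Q \<subseteq> down_closure (subsystem X T) \<sigma> \<and> \<sigma> = maximal_elements (subsystem X T) Q \<longleftrightarrow>
    splits T Q \<sigma>" for Q
  proof (cases "Q \<subseteq> T \<and> (\<forall>x\<in>T. x \<in> Q \<longleftrightarrow> inv x \<notin> Q)")
    case True
    with con[of Q] dn[of Q] show ?thesis
      unfolding splits_def ori mx by argo
  next
    case False
    then show ?thesis
      unfolding splits_def by (simp only: ori) blast
  qed
  then show ?thesis
    unfolding splitting_star_def by simp
qed

lemma splits_finiteI:
  assumes "finite Q" "T \<subseteq> seps X" "Q \<subseteq> T" "\<And>x. x \<in> T \<Longrightarrow> x \<in> Q \<longleftrightarrow> inv x \<notin> Q"
    "\<And>r s. r \<in> Q \<Longrightarrow> s \<in> Q \<Longrightarrow> inv r \<preceq> s \<Longrightarrow> r = s"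
  shows "splits T Q (maximal_elements X Q)"
  unfolding splits_def using assms ex_maximal_above[of Q] by auto

lemma nested_cases:
  assumes "nested X T" "T \<subseteq> seps X" "r \<in> T" "s \<in> T"
  obtains "r \<preceq> s" | "s \<preceq> r" | "r \<preceq> inv s" | "inv r \<preceq> s"
proof -
  have "r \<in> seps X" "s \<in> seps X" using assms by auto
  then show ?thesis
    using assms that unfolding nested_def nested_pair_def underlying_def
    by (metis (no_types, lifting) inv_le_inv le_inv_swap inv_le_swap insertE singletonD)
qed

lemma nestedI:
  assumes "T \<subseteq> seps X"
    and "\<And>r s. r \<in> T \<Longrightarrow> s \<in> T \<Longrightarrow> r \<preceq> s \<or> s \<preceq> r \<or> r \<preceq> inv s \<or> inv r \<preceq> s"
  shows "nested X T"
  unfolding nested_def nested_pair_def underlying_def using assms(2) by blast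

lemma nested_symmetrize:
  assumes "nested X T" "T \<subseteq> seps X"
  shows "nested X (T \<union> inv ` T)"
proof (rule nestedI)
  show "T \<union> inv ` T \<subseteq> seps X" using assms by auto
  fix r s
  assume "r \<in> T \<union> inv ` T" "s \<in> T \<union> inv ` T"
  then obtain r' s' where "r' \<in> T" "s' \<in> T" "r = r' \<or> r = inv r'" "s = s' \<or> s = inv s'"
    by blast
  moreover from this have "r' \<in> seps X" "s' \<in> seps X" using assms by auto
  ultimately show "r \<preceq> s \<or> s \<preceq> r \<or> r \<preceq> inv s \<or> inv r \<preceq> s"
    using nested_cases[OF assms] inv_le_inv le_inv_swap inv_le_swap inv_inv by metis
qed

text \<open>Of the four ways in which two distinct maximal elements of \<open>Q\<close> can be
  nested, maximality excludes two and consistency excludes \<open>inv r \<preceq> s\<close>; only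
  the star inequality is left.\<close>

lemma splits_star:
  assumes "splits T Q \<sigma>" "nested X T" "T \<subseteq> seps X"
  shows "star X \<sigma>"
  unfolding star_def
proof (intro conjI ballI impI)
  have \<sigma>: "\<sigma> \<subseteq> Q" "Q \<subseteq> T" "\<sigma> = maximal_elements X Q"
    using assms mem_maximal_elements by (auto simp: splits_def)
  then show "\<sigma> \<subseteq> seps X" using assms by auto
  fix r s
  assume rs: "r \<in> \<sigma>" "s \<in> \<sigma>" "r \<noteq> s"
  then have "r \<in> T" "s \<in> T" "r \<in> Q" "s \<in> Q" using \<sigma> by auto
  then show "r \<preceq> inv s"
    using nested_cases[OF assms(2,3), of r s] rs assms(1) mem_maximal_elements \<sigma>(3)
    unfolding splits_def by metis
qed

text \<open>In each of the four nested cases \<open>y\<close> ends up below \<open>a\<close>: by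
  maximality of \<open>a\<close>, by consistency, or through the inverse of \<open>a\<close>, which
  lies below \<open>a\<close>.\<close>

lemma splits_cosmall:
  assumes sp: "splits T Q \<sigma>" and T: "nested X T" "T \<subseteq> seps X"
    and a: "a \<in> \<sigma>" "inv a \<preceq> a"
  shows "\<And>y. y \<in> Q \<Longrightarrow> y \<preceq> a" and "\<sigma> = {a}"
proof -
  have \<sigma>: "\<sigma> \<subseteq> Q" "Q \<subseteq> T" "\<sigma> = maximal_elements X Q"
    using sp mem_maximal_elements by (auto simp: splits_def)
  show le: "y \<preceq> a" if "y \<in> Q" for y
  proof -
    have "a \<in> T" "y \<in> T" "a \<in> Q" "a \<in> seps X" "y \<in> seps X" using \<sigma> a that T by auto
    then show ?thesis
      using nested_cases[OF T, of y a] a that sp \<sigma>(3) mem_maximal_elements refl trans inv_closed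
      unfolding splits_def by metis
  qed
  show "\<sigma> = {a}"
    using le \<sigma> a(1) mem_maximal_elements by blast
qed

end

section \<open>Homomorphisms and their effect on cores\<close>

locale separation_hom = X: separation_system X + Y: separation_system Y
  for X :: "'a sepsys" and Y :: "'b sepsys" +
  fixes h :: "'a \<Rightarrow> 'b"
  assumes hom: "sep_hom X Y h"
begin

lemma hom_closed [simp]: "a \<in> seps X \<Longrightarrow> h a \<in> seps Y"
  using hom unfolding sep_hom_def by blast

lemma hom_inv [simp]: "a \<in> seps X \<Longrightarrow> h (sinv X a) = sinv Y (h a)"
  using hom unfolding sep_hom_def by blast

lemma hom_mono: "sle X a b \<Longrightarrow> a \<in> seps X \<Longrightarrow> b \<in> seps X \<Longrightarrow> sle Y (h a) (h b)"
  using hom unfolding sep_hom_def by blast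

lemma star_image: "star X \<sigma> \<Longrightarrow> star Y (h ` \<sigma>)"
  unfolding star_def
  by (auto simp: subset_iff) (metis X.inv_closed hom_inv hom_mono)

lemma sym_subset_image: "X.sym_subset T \<Longrightarrow> Y.sym_subset (h ` T)"
  unfolding X.sym_subset_def Y.sym_subset_def
  by (auto simp: subset_iff) (metis hom_inv image_eqI)

lemma nested_image:
  assumes "nested X T" "T \<subseteq> seps X"
  shows "nested Y (h ` T)"
proof (rule Y.nestedI)
  show "h ` T \<subseteq> seps Y" using assms by auto
  fix r s
  assume "r \<in> h ` T" "s \<in> h ` T"
  then obtain r' s' where *: "r = h r'" "s = h s'" "r' \<in> T" "s' \<in> T" by blast
  then have "r' \<in> seps X" "s' \<in> seps X" using assms by auto
  then show "sle Y r s \<or> sle Y s r \<or> sle Y r (sinv Y s) \<or> sle Y (sinv Y r) s"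
    using * X.nested_cases[OF assms *(3,4)] hom_mono hom_inv X.inv_closed by metis
qed

text \<open>Passing to the core loses no co-small image. If \<open>v\<close> lies strictly below a
  core element \<open>c\<close>, the star inequality puts \<open>h c\<close> below the inverse of
  \<open>h v\<close>, hence below \<open>h v\<close>, while monotonicity gives the converse.\<close>

lemma cosmall_image_core:
  assumes st: "star X \<sigma>" and fin: "finite \<sigma>" and v: "v \<in> \<sigma>" "sle Y (sinv Y (h v)) (h v)"
  shows "\<exists>c\<in>core X \<sigma>. h c = h v"
proof -
  obtain c where c: "c \<in> core X \<sigma>" "sle X v c"
    using X.ex_core_above[OF st fin v(1)] by blast
  have mem: "v \<in> seps X" "c \<in> seps X" "c \<in> \<sigma>"
    using c v st X.star_subset X.core_subset by blast+
  show ?thesis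
  proof (cases "c = v")
    case False
    have "sle X v (sinv X c)"
      using X.starD[OF st v(1) mem(3)] False by blast
    then have "sle Y (h v) (sinv Y (h c))"
      using hom_mono mem by fastforce
    then have "sle Y (h c) (sinv Y (h v))"
      using mem Y.le_inv_swap by simp
    then have "sle Y (h c) (h v)"
      using Y.trans[OF _ v(2)] mem by simp
    then show ?thesis
      using c hom_mono Y.antisym mem hom_closed by meson
  qed (use c in blast)
qed

text \<open>Says when the core of an image star depends on the core of the star alone: as long as no
  core element becomes co-small, the whole image has no co-small element, and its maximal elements
  come from the core.\<close>

lemma core_image_without_cosmall:
  assumes st: "star X \<sigma>" and fin: "finite \<sigma>"
    and nc: "\<And>c. c \<in> core X \<sigma> \<Longrightarrow> \<not> sle Y (sinv Y (h c)) (h c)"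
  shows "core Y (h ` \<sigma>) = maximal_elements Y (h ` core X \<sigma>)"
proof -
  have "core Y (h ` \<sigma>) = maximal_elements Y (h ` \<sigma>)"
  proof (rule Y.core_without_cosmall[OF star_image[OF st]])
    fix z assume "z \<in> h ` \<sigma>"
    then show "\<not> sle Y (sinv Y z) z"
      using cosmall_image_core[OF st fin] nc by (metis imageE)
  qed
  also have "\<dots> = maximal_elements Y (h ` core X \<sigma>)"
  proof -
    have "\<exists>w\<in>h ` core X \<sigma>. sle Y v w" if "v \<in> h ` \<sigma>" for v
      using that X.ex_core_above[OF st fin] hom_mono X.star_subset[OF st] X.core_subset[of \<sigma>]
      by (smt (verit, best) image_iff subset_iff)
    moreover have "h ` core X \<sigma> \<subseteq> h ` \<sigma>" "h ` \<sigma> \<subseteq> seps Y"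
      using X.core_subset[of \<sigma>] X.star_subset[OF st] by auto
    ultimately show ?thesis
      unfolding set_eq_iff Y.mem_maximal_elements using Y.trans Y.antisym
      by (smt (verit, ccfv_threshold) subset_iff)
  qed
  finally show ?thesis .
qed

text \<open>A core consisting of orientations of one separation keeps this form. Which orientations
  remain depends on whether \<open>h c\<close> or its inverse becomes co-small, and then on whether
  the other orientation is in the image; otherwise the core is computed from maximal
  elements.\<close>

lemma core_image_single:
  assumes st: "star X \<sigma>" and fin: "finite \<sigma>"
    and core: "core X \<sigma> = {c} \<or> core X \<sigma> = {c, sinv X c}"
  shows "core Y (h ` \<sigma>) = {h c} \<or> core Y (h ` \<sigma>) = {h c, sinv Y (h c)}"
proof -
  have c: "c \<in> \<sigma>" "c \<in> seps X"
    using core X.core_subset[of \<sigma>] X.star_subset[OF st] by auto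
  have st': "star Y (h ` \<sigma>)" using star_image st .
  consider "sle Y (sinv Y (h c)) (h c)"
    | "sle Y (h c) (sinv Y (h c))" "core X \<sigma> = {c, sinv X c}"
    | "\<not> sle Y (sinv Y (h c)) (h c)" "core X \<sigma> = {c}"
    | "\<not> sle Y (sinv Y (h c)) (h c)" "\<not> sle Y (h c) (sinv Y (h c))" "core X \<sigma> = {c, sinv X c}"
    using core by blast
  then show ?thesis
  proof cases
    case 1
    then have "core Y (h ` \<sigma>) = insert (h c) ({sinv Y (h c)} \<inter> h ` \<sigma>)"
      using Y.core_with_cosmall[OF st', of "h c"] c by blast
    then show ?thesis by blast
  next
    case 2
    then have "sinv X c \<in> \<sigma>" using X.core_subset[of \<sigma>] by auto
    then have "sinv Y (h c) \<in> h ` \<sigma>" using c hom_inv by (metis imageI)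
    then show ?thesis
      using Y.core_with_cosmall[OF st', of "sinv Y (h c)"] 2 c by auto
  next
    case 3
    then have "core Y (h ` \<sigma>) = maximal_elements Y {h c}"
      using core_image_without_cosmall[OF st fin] by simp
    then show ?thesis
      using Y.mem_maximal_elements by auto
  next
    case 4
    then have "\<not> sle Y (sinv Y (h d)) (h d)" if "d \<in> core X \<sigma>" for d
      using that c by auto
    then have "core Y (h ` \<sigma>) = maximal_elements Y {h c, sinv Y (h c)}"
      using core_image_without_cosmall[OF st fin] 4(3) c by simp
    then show ?thesis
      using Y.mem_maximal_elements 4 by auto
  qed
qed

end

section \<open>Inheritance of \<open>essentially_over\<close> by homomorphic images\<close>

context separation_hom
begin

text \<open>A splitting star of the image is pulled back to one of \<open>T\<close>. Pulling back the orientation itself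
  can fail to be consistent only over a co-small maximal element \<open>a\<close>; there one element over \<open>a\<close>,
  chosen minimal, is kept and all others over \<open>a\<close> are reversed.\<close>

lemma essentially_over_image:
  assumes fin: "finite (seps X)"
    and T: "X.sym_subset T" "nested X T"
    and nd: "\<And>y. y \<in> h ` T \<Longrightarrow> sinv Y y \<noteq> y"
    and over: "essentially_over X T G"
    and stars: "\<And>\<rho>. \<rho> \<in> G \<Longrightarrow> star X \<rho>"
    and GH: "\<And>\<rho>. \<rho> \<in> G \<Longrightarrow> h ` \<rho> \<in> H \<or> (\<exists>a. core X \<rho> = {a} \<and> {h a} \<in> H)"
  shows "essentially_over Y (h ` T) H"
  unfolding essentially_over_def
proof (intro allI impI)
  fix \<sigma>
  assume "splitting_star Y (h ` T) \<sigma>"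
  have Tsub: "T \<subseteq> seps X" and Tinv: "\<And>x. x \<in> T \<Longrightarrow> sinv X x \<in> T"
    using T(1) by (auto simp: X.sym_subset_def)
  have finT: "finite T" using fin Tsub finite_subset by blast
  have hT: "Y.sym_subset (h ` T)" "h ` T \<subseteq> seps Y" "nested Y (h ` T)"
    using sym_subset_image[OF T(1)] nested_image[OF T(2) Tsub] by (auto simp: Y.sym_subset_def)
  have ndT: "sinv X x \<noteq> x" if "x \<in> T" for x
    using nd[of "h x"] that hom_inv Tsub by (metis imageI subsetD)
  obtain Q where Q: "Y.splits (h ` T) Q \<sigma>"
    using Y.splitting_star_iff[OF hT(1) nd] \<open>splitting_star Y (h ` T) \<sigma>\<close> by blast
  have Qsub: "Q \<subseteq> h ` T" "\<sigma> \<subseteq> Q" and \<sigma>: "\<sigma> = maximal_elements Y Q"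
    and Qor: "\<And>x. x \<in> h ` T \<Longrightarrow> x \<in> Q \<longleftrightarrow> sinv Y x \<notin> Q"
    and Qcon: "\<And>r s. r \<in> Q \<Longrightarrow> s \<in> Q \<Longrightarrow> sle Y (sinv Y r) s \<Longrightarrow> r = s"
    and Qdom: "\<And>x. x \<in> Q \<Longrightarrow> \<exists>s\<in>\<sigma>. sle Y x s"
    using Q Y.mem_maximal_elements unfolding Y.splits_def by auto
  have ex_G: "\<exists>\<rho>\<in>G. maximal_elements X R = core X \<rho> \<or>
      (\<exists>s\<in>seps X. maximal_elements X R = {s} \<and> core X \<rho> = {s, sinv X s})"
    if "R \<subseteq> T" "\<And>x. x \<in> T \<Longrightarrow> x \<in> R \<longleftrightarrow> sinv X x \<notin> R"
      "\<And>r s. r \<in> R \<Longrightarrow> s \<in> R \<Longrightarrow> sle X (sinv X r) s \<Longrightarrow> r = s" for R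
  proof -
    have "X.splits T R (maximal_elements X R)"
      using that Tsub finite_subset[OF _ finT] by (intro X.splits_finiteI) auto
    then show ?thesis
      using over X.splitting_star_iff[OF T(1) ndT] unfolding essentially_over_def by blast
  qed
  have single: "\<exists>\<tau>\<in>H. \<sigma> = core Y \<tau> \<or> (\<exists>s\<in>seps Y. \<sigma> = {s} \<and> core Y \<tau> = {s, sinv Y s})"
    if "\<tau> \<in> H" "\<sigma> = {b}" "core Y \<tau> = {b} \<or> core Y \<tau> = {b, sinv Y b}" "b \<in> seps Y" for \<tau> b
    using that by blast
  show "\<exists>\<tau>\<in>H. \<sigma> = core Y \<tau> \<or> (\<exists>s\<in>seps Y. \<sigma> = {s} \<and> core Y \<tau> = {s, sinv Y s})"
  proof (cases "\<exists>a\<in>\<sigma>. sle Y (sinv Y a) a")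
    case True
    then obtain a where a: "a \<in> \<sigma>" "sle Y (sinv Y a) a" by blast
    have aT: "a \<in> h ` T" "a \<in> seps Y" "a \<in> Q" using a Qsub hT by auto
    have le_a: "\<And>y. y \<in> Q \<Longrightarrow> sle Y y a" and \<sigma>a: "\<sigma> = {a}"
      using Y.splits_cosmall[OF Q hT(3,2) a] by auto
    have not_le: "\<not> sle Y a (sinv Y a)"
      using a(2) Y.antisym nd aT by (metis Y.inv_closed)
    let ?M = "{x \<in> T. h x = a}"
    have "asymp_on ?M (slt X)"
      using Tsub X.antisym unfolding slt_def asymp_on_def by blast
    moreover have "transp_on ?M (slt X)"
    proof (rule transp_onI)
      fix u v w
      assume "u \<in> ?M" "v \<in> ?M" "w \<in> ?M" and *: "slt X u v" "slt X v w"
      then have "u \<in> seps X" "v \<in> seps X" "w \<in> seps X" using Tsub by auto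
      then show "slt X u w" using * X.trans X.antisym unfolding slt_def by metis
    qed
    ultimately obtain y where y: "y \<in> T" "h y = a"
      and ymin: "\<And>x. x \<in> T \<Longrightarrow> h x = a \<Longrightarrow> sle X x y \<Longrightarrow> x = y"
      using Finite_Set.bex_min_element[of ?M "slt X"] finT aT unfolding slt_def by force
    have ySX: "y \<in> seps X" using y Tsub by blast
    \<comment> \<open>\<open>?B\<close> is the plain preimage away from \<open>a\<close>;
      \<open>?C\<close> consists of the inverses of all elements over \<open>a\<close> other than
      \<open>y\<close>.\<close>
    let ?B = "{b \<in> T. h b \<in> Q \<and> h b \<noteq> a}"
    let ?C = "{x \<in> T. h x = sinv Y a \<and> x \<noteq> sinv X y}"
    define R where "R = ?B \<union> {y} \<union> ?C"
    have na: "sinv Y a \<noteq> a" "sinv Y a \<notin> Q" using nd aT Qor by blast+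
    have Rsub: "R \<subseteq> T" using y by (auto simp: R_def)
    have Rle: "sle Y (h b) a" if "b \<in> R" for b
      using that le_a a aT y by (auto simp: R_def Y.refl)
    have Rnota: "h b \<noteq> a" if "b \<in> R" "b \<noteq> y" for b
      using that na by (auto simp: R_def)
    have Ror: "x \<in> R \<longleftrightarrow> sinv X x \<notin> R" if x: "x \<in> T" for x
    proof -
      have x': "x \<in> seps X" "sinv X x \<in> T" "h x \<in> seps Y" using x Tsub Tinv by auto
      have *: "h (sinv X x) = sinv Y (h x)" using x' by simp
      consider "h x = a" | "h x = sinv Y a" | "h x \<noteq> a" "h x \<noteq> sinv Y a" by blast
      then show ?thesis
      proof cases
        case 1
        have "x \<in> R \<longleftrightarrow> x = y" using 1 na by (auto simp: R_def y)
        moreover have "sinv X x \<in> R \<longleftrightarrow> sinv X x \<noteq> sinv X y"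
          using 1 * na x' y by (auto simp: R_def)
        ultimately show ?thesis using x' ySX X.inv_inv by metis
      next
        case 2
        then have hx: "h (sinv X x) = a" using * aT by simp
        have "x \<in> R \<longleftrightarrow> x \<noteq> sinv X y" using 2 na x y by (auto simp: R_def)
        moreover have "sinv X x \<in> R \<longleftrightarrow> sinv X x = y" using hx na by (auto simp: R_def y)
        ultimately show ?thesis using x' ySX X.inv_inv by metis
      next
        case 3
        then have 4: "sinv Y (h x) \<noteq> a" "sinv Y (h x) \<noteq> sinv Y a"
          using x' aT Y.inv_inv by metis+
        have "x \<in> R \<longleftrightarrow> h x \<in> Q" using 3 x y by (auto simp: R_def)
        moreover have "sinv X x \<in> R \<longleftrightarrow> sinv Y (h x) \<in> Q" using 4 * x' y by (auto simp: R_def)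
        ultimately show ?thesis using Qor[of "h x"] x by blast
      qed
    qed
    have Rcon: "r = s" if rs: "r \<in> R" "s \<in> R" "sle X (sinv X r) s" for r s
    proof (rule ccontr)
      assume "r \<noteq> s"
      have mem: "r \<in> seps X" "s \<in> seps X" "r \<in> T" "s \<in> T" using rs Rsub Tsub by auto
      have le: "sle Y (sinv Y (h r)) (h s)" using hom_mono[OF rs(3)] mem by simp
      have le': "sle Y (sinv Y (h s)) (h r)" using le mem Y.inv_le_swap by simp
      have C: False if "u \<in> ?C" "v \<in> R" "sle X (sinv X u) v" for u v
      proof -
        have u: "u \<in> seps X" "v \<in> seps X" "h u = sinv Y a" "u \<noteq> sinv X y" using that Rsub Tsub by auto
        then have hu: "h (sinv X u) = a" "sinv X u \<in> T" using aT Tinv that by auto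
        then have "sle Y a (h v)" using hom_mono[OF that(3)] u by simp
        then have "h v = a" using Rle[OF that(2)] Y.antisym aT u hom_closed by blast
        then have "v = y" using Rnota that(2) by blast
        then have "sinv X u = y" using ymin[OF hu(2,1)] that(3) by blast
        then show False using u X.inv_inv by metis
      qed
      have le2: "sle X (sinv X s) r" using rs(3) mem X.inv_le_swap by simp
      have "r \<notin> ?C" "s \<notin> ?C" using C[OF _ rs(2,3)] C[OF _ rs(1) le2] by blast+
      then have "h r \<in> Q" "h s \<in> Q" using rs y aT by (auto simp: R_def)
      then have "h r = h s" using Qcon le by blast
      show False
      proof (cases "h r = a")
        case True
        then show False using Rnota rs(1,2) \<open>h r = h s\<close> \<open>r \<noteq> s\<close> by metis
      next
        \<comment> \<open>Here \<open>h r\<close> lies below \<open>a\<close>, so the inverse of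
          \<open>a\<close> is below the inverse of \<open>h r\<close>, hence below
          \<open>h r\<close>. Consistency of \<open>Q\<close> then forces
          \<open>h r = a\<close>.\<close>
        case False
        have "sle Y (sinv Y a) (sinv Y (h r))"
          using le_a[OF \<open>h r \<in> Q\<close>] aT mem by simp
        then have "sle Y (sinv Y a) (h r)"
          using le \<open>h r = h s\<close> Y.trans aT mem by (metis Y.inv_closed hom_closed)
        then show False using Qcon[OF aT(3) \<open>h r \<in> Q\<close>] False by blast
      qed
    qed
    have ymax: "y \<in> maximal_elements X R"
      unfolding X.mem_maximal_elements
    proof (intro conjI ballI impI)
      fix b assume b: "b \<in> R" "sle X y b"
      then have bX: "b \<in> seps X" using Rsub Tsub by blast
      then have "sle Y a (h b)" using hom_mono[OF b(2) ySX bX] y by simp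
      then have "h b = a" using Rle[OF b(1)] Y.antisym aT bX hom_closed by blast
      then show "y = b" using Rnota b(1) by blast
    qed (simp add: R_def)
    obtain \<rho> where \<rho>: "\<rho> \<in> G" and "maximal_elements X R = core X \<rho> \<or>
        (\<exists>s\<in>seps X. maximal_elements X R = {s} \<and> core X \<rho> = {s, sinv X s})"
      using ex_G[OF Rsub Ror Rcon] by blast
    \<comment> \<open>Both alternatives for \<rho> put \<open>y\<close> into its core. As
      \<open>a\<close> is co-small, its mere presence in the image of \<rho> determines the core
      there up to the inverse of \<open>a\<close>.\<close>
    then have yc: "y \<in> core X \<rho>" using ymax by auto
    show ?thesis
      using GH[OF \<rho>]
    proof (elim disjE exE conjE)
      assume "h ` \<rho> \<in> H"
      moreover have "a \<in> h ` \<rho>" using yc y X.core_subset by blast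
      then have "core Y (h ` \<rho>) = insert a ({sinv Y a} \<inter> h ` \<rho>)"
        using Y.core_with_cosmall[OF star_image[OF stars[OF \<rho>]] _ a(2)] by blast
      then have "core Y (h ` \<rho>) = {a} \<or> core Y (h ` \<rho>) = {a, sinv Y a}" by blast
      ultimately show ?thesis using single \<sigma>a aT by blast
    next
      fix c assume "core X \<rho> = {c}" "{h c} \<in> H"
      then show ?thesis using yc y single[of "{a}" a] \<sigma>a aT by auto
    qed
  next
    case False
    define R where "R = {x \<in> T. h x \<in> Q}"
    have Rsub: "R \<subseteq> T" by (auto simp: R_def)
    have hR: "h ` R = Q" using Qsub by (auto simp: R_def)
    have Ror: "x \<in> R \<longleftrightarrow> sinv X x \<notin> R" if "x \<in> T" for x
    proof -
      have "h (sinv X x) = sinv Y (h x)" using that Tsub by auto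
      then show ?thesis using that Tinv Qor[of "h x"] by (simp add: R_def)
    qed
    \<comment> \<open>Co-smallness passes upwards, so it would reach \<sigma>. Its absence makes the
      plain preimage \<open>R\<close> consistent: two distinct elements violating consistency would
      have a common co-small image.\<close>
    have nc: "\<not> sle Y (sinv Y b) b" if "b \<in> Q" for b
      using False Qdom[OF that] Y.cosmall_mono that Qsub hT(2) by (meson subsetD)
    have Rcon: "r = s" if rs: "r \<in> R" "s \<in> R" "sle X (sinv X r) s" for r s
    proof -
      have mem: "r \<in> seps X" "s \<in> seps X" "h r \<in> Q" "h s \<in> Q"
        using rs Tsub by (auto simp: R_def)
      then have le: "sle Y (sinv Y (h r)) (h s)" using hom_mono[OF rs(3)] by simp
      then have "h r = h s" using Qcon mem by blast
      then show ?thesis using le nc mem by metis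
    qed
    have finR: "finite R" using finT Rsub finite_subset by blast
    have hmax: "maximal_elements Y (h ` maximal_elements X R) = \<sigma>"
    proof -
      have dom: "\<exists>m\<in>maximal_elements X R. sle Y b (h m)" if "b \<in> Q" for b
      proof -
        obtain x where x: "x \<in> R" "b = h x" using \<open>b \<in> Q\<close> hR by blast
        then obtain m where m: "m \<in> maximal_elements X R" "sle X x m"
          using X.ex_maximal_above[OF finR] Rsub Tsub by blast
        moreover have "m \<in> R" using m X.mem_maximal_elements by blast
        ultimately show ?thesis using x hom_mono Rsub Tsub by blast
      qed
      moreover have "h ` maximal_elements X R \<subseteq> Q"
        using X.mem_maximal_elements hR by blast
      moreover have "Q \<subseteq> seps Y" using Qsub hT by blast
      ultimately show ?thesis
        unfolding set_eq_iff \<sigma> Y.mem_maximal_elements using Y.trans Y.antisym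
        by (smt (verit, ccfv_threshold) image_iff subset_iff)
    qed
    have ncmax: "\<not> sle Y (sinv Y (h c)) (h c)" if "c \<in> maximal_elements X R" for c
      using that nc hR X.mem_maximal_elements by blast
    obtain \<rho> where \<rho>: "\<rho> \<in> G" and alt: "maximal_elements X R = core X \<rho> \<or>
        (\<exists>s\<in>seps X. maximal_elements X R = {s} \<and> core X \<rho> = {s, sinv X s})"
      using ex_G[OF Rsub Ror Rcon] by blast
    have st: "star X \<rho>" using stars \<rho> .
    have fin\<rho>: "finite \<rho>" using X.star_subset[OF st] fin finite_subset by blast
    have sing: "\<sigma> = {h s}" if "maximal_elements X R = {s}" for s
      using hmax that Y.mem_maximal_elements by auto
    show ?thesis
      using GH[OF \<rho>]
    proof (elim disjE exE conjE)
      assume H: "h ` \<rho> \<in> H"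
      show ?thesis
        using alt
      proof (elim disjE bexE conjE)
        assume "maximal_elements X R = core X \<rho>"
        then have "\<sigma> = core Y (h ` \<rho>)"
          using core_image_without_cosmall[OF st fin\<rho>] hmax ncmax by simp
        then show ?thesis using H by blast
      next
        fix s assume s: "s \<in> seps X" "maximal_elements X R = {s}" "core X \<rho> = {s, sinv X s}"
        then show ?thesis
          using core_image_single[OF st fin\<rho>, of s] single[OF H] sing by simp
      qed
    next
      fix c assume c: "core X \<rho> = {c}" "{h c} \<in> H"
      then have "c \<in> seps X" using X.core_subset X.star_subset[OF st] by blast
      moreover have "maximal_elements X R = {c}" using alt c by auto
      ultimately show ?thesis using single[OF c(2)] sing by simp
    qed
  qed
qed

end

section \<open>Inverse limits of separation systems\<close>

locale separation_inverse_system =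
  fixes S :: "'p::order \<Rightarrow> 'a sepsys" and f :: "'p \<Rightarrow> 'p \<Rightarrow> 'a \<Rightarrow> 'a"
  assumes directed: "\<And>p q :: 'p. \<exists>r. p \<le> r \<and> q \<le> r"
    and system: "inverse_system S f"
    and finite_level: "\<And>p. finite (seps (S p))"
begin

abbreviation "L \<equiv> inv_limit S f"

text \<open>The bonding maps extended by the identity on the diagonal, so that arguments apply to
  \<open>p \<le> q\<close> and need no case \<open>p = q\<close>.\<close>

definition bond :: "'p \<Rightarrow> 'p \<Rightarrow> 'a \<Rightarrow> 'a" where
  "bond q p = (if q = p then (\<lambda>a. a) else f q p)"

definition evtl :: "('p \<Rightarrow> bool) \<Rightarrow> bool" where
  "evtl P \<longleftrightarrow> (\<exists>p. \<forall>q\<ge>p. P q)"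

lemma evtl_conj: "evtl P \<Longrightarrow> evtl Q \<Longrightarrow> evtl (\<lambda>p. P p \<and> Q p)"
  unfolding evtl_def using directed order_trans by metis

lemma evtl_mono: "evtl P \<Longrightarrow> (\<And>p. P p \<Longrightarrow> Q p) \<Longrightarrow> evtl Q"
  unfolding evtl_def by blast

lemma evtl_above: "evtl P \<Longrightarrow> \<exists>q\<ge>p. P q"
  unfolding evtl_def using directed by blast

text \<open>The dichotomy behind the compactness arguments below: a property inherited by smaller
  indices either holds everywhere, which allows a passage to the limit, or fails from some index
  on.\<close>

lemma all_or_evtl_not:
  assumes "\<And>p q. p \<le> q \<Longrightarrow> Q q \<Longrightarrow> Q p"
  shows "(\<forall>p. Q p) \<or> evtl (\<lambda>p. \<not> Q p)"
  unfolding evtl_def using assms by blast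

lemma level_system: "separation_system (S p)"
  using system unfolding inverse_system_def separation_system_def by blast

sublocale lev: separation_system "S p" for p
  by (rule level_system)

lemma mem_limit:
  "x \<in> seps L \<longleftrightarrow> (\<forall>p. x p \<in> seps (S p)) \<and> (\<forall>p q. p < q \<longrightarrow> f q p (x q) = x p)"
  by (simp add: inv_limit_def)

lemma le_limit: "sle L x y \<longleftrightarrow> (\<forall>p. sle (S p) (x p) (y p))"
  by (simp add: inv_limit_def)

lemma inv_limit_apply [simp]: "sinv L x p = sinv (S p) (x p)"
  by (simp add: inv_limit_def)

lemma limit_apply [simp]: "x \<in> seps L \<Longrightarrow> x p \<in> seps (S p)"
  by (simp add: mem_limit)

lemma bond_limit: "x \<in> seps L \<Longrightarrow> p \<le> q \<Longrightarrow> bond q p (x q) = x p"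
  by (simp add: mem_limit bond_def)

lemma f_hom: "p < q \<Longrightarrow> sep_hom (S q) (S p) (f q p)"
  using system unfolding inverse_system_def by blast

lemma f_comp: "p < q \<Longrightarrow> q < r \<Longrightarrow> a \<in> seps (S r) \<Longrightarrow> f r p a = f q p (f r q a)"
  using system unfolding inverse_system_def by blast

lemma bond_hom: "p \<le> q \<Longrightarrow> separation_hom (S q) (S p) (bond q p)"
  using f_hom[of p q] level_system
  by (auto simp: separation_hom_def separation_hom_axioms_def bond_def sep_hom_def)

lemma sinv_limit_closed: "x \<in> seps L \<Longrightarrow> sinv L x \<in> seps L"
  using f_hom unfolding mem_limit sep_hom_def by simp

lemma limit_system: "separation_system L"
proof
  show "sep_system L"
    unfolding sep_system_def
  proof (intro conjI ballI impI)
    show "reflp_on (seps L) (sle L)"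
      by (auto simp: reflp_on_def le_limit lev.refl)
    show "transp_on (seps L) (sle L)"
      by (rule transp_onI) (meson le_limit lev.trans limit_apply)
    show "antisymp_on (seps L) (sle L)"
      by (rule antisymp_onI, rule ext) (meson le_limit lev.antisym limit_apply)
    fix s assume s: "s \<in> seps L"
    show "sinv L s \<in> seps L" using s by (rule sinv_limit_closed)
    show "sinv L (sinv L s) = s" using s by (intro ext) simp
  next
    fix r s assume "r \<in> seps L" "s \<in> seps L" "sle L r s"
    then show "sle L (sinv L s) (sinv L r)"
      by (simp add: le_limit)
  qed
qed

sublocale lim: separation_system L
  by (rule limit_system)

lemma proj_hom: "separation_hom L (S p) (\<lambda>x. x p)"
  using level_system limit_system
  by (simp add: separation_hom_def separation_hom_axioms_def sep_hom_def le_limit)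

lemma proj_bond: "p \<le> q \<Longrightarrow> \<sigma> \<subseteq> seps L \<Longrightarrow> bond q p ` proj q \<sigma> = proj p \<sigma>"
  unfolding proj_def image_image using bond_limit by (auto intro!: image_cong)

lemma finite_proj: "\<sigma> \<subseteq> seps L \<Longrightarrow> finite (proj p \<sigma>)"
  by (rule finite_subset[OF _ finite_level[of p]]) (auto simp: proj_def)

lemma star_proj: "star L \<sigma> \<Longrightarrow> star (S p) (proj p \<sigma>)"
  unfolding proj_def by (rule separation_hom.star_image[OF proj_hom])

lemma le_below:
  "sle (S q) (x q) (y q) \<Longrightarrow> p \<le> q \<Longrightarrow> x \<in> seps L \<Longrightarrow> y \<in> seps L \<Longrightarrow> sle (S p) (x p) (y p)"
  using separation_hom.hom_mono[OF bond_hom, of p q "x q" "y q"] bond_limit by simp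

lemma eq_below: "x q = y q \<Longrightarrow> p \<le> q \<Longrightarrow> x \<in> seps L \<Longrightarrow> y \<in> seps L \<Longrightarrow> x p = y p"
  using bond_limit by metis

lemma evtl_not_le:
  "\<not> sle L x y \<Longrightarrow> x \<in> seps L \<Longrightarrow> y \<in> seps L \<Longrightarrow> evtl (\<lambda>q. \<not> sle (S q) (x q) (y q))"
  unfolding le_limit evtl_def using le_below by blast

lemma evtl_neq: "x \<noteq> y \<Longrightarrow> x \<in> seps L \<Longrightarrow> y \<in> seps L \<Longrightarrow> evtl (\<lambda>q. x q \<noteq> y q)"
  unfolding evtl_def using eq_below by (metis ext)

text \<open>The pairs \<open>(x p, y p)\<close> with \<open>(x, y) \<in> R p\<close> form finite
  nonempty sets mapped into each other by the bonding maps. A compatible choice is a pair of limit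
  elements that is only approximated by \<open>R p\<close> at each level; it need not belong to any
  \<open>R p\<close>.\<close>

lemma limit_point2:
  fixes R :: "'p \<Rightarrow> (('p \<Rightarrow> 'a) \<times> ('p \<Rightarrow> 'a)) set"
  assumes sub: "\<And>p. R p \<subseteq> seps L \<times> seps L"
    and anti: "\<And>p q. p \<le> q \<Longrightarrow> R q \<subseteq> R p" and ne: "\<And>p. R p \<noteq> {}"
  shows "\<exists>x\<in>seps L. \<exists>y\<in>seps L. \<forall>p. \<exists>(x', y')\<in>R p. x' p = x p \<and> y' p = y p"
proof -
  let ?A = "\<lambda>p. (\<lambda>(x, y). (x p, y p)) ` R p"
  have "\<exists>z. (\<forall>p. z p \<in> ?A p) \<and> (\<forall>p q. p < q \<longrightarrow> map_prod (f q p) (f q p) (z q) = z p)"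
  proof (rule finite_inverse_limit_nonempty[OF directed])
    show "finite (?A p)" for p
    proof (rule finite_subset)
      show "?A p \<subseteq> seps (S p) \<times> seps (S p)" using sub[of p] by auto
      show "finite (seps (S p) \<times> seps (S p))" using finite_level by blast
    qed
    show "?A p \<noteq> {}" for p using ne by simp
    show "map_prod (f q p) (f q p) z \<in> ?A p" if pq: "p < q" and z: "z \<in> ?A q" for p q z
    proof -
      obtain x y where "(x, y) \<in> R q" "z = (x q, y q)" using z by auto
      moreover from this have "(x, y) \<in> R p" "x \<in> seps L" "y \<in> seps L"
        using anti[OF less_imp_le[OF pq]] sub by blast+
      ultimately show ?thesis using pq by (force simp: mem_limit)
    qed
    show "map_prod (f r p) (f r p) z = map_prod (f q p) (f q p) (map_prod (f r q) (f r q) z)"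
      if "p < q" "q < r" "z \<in> ?A r" for p q r z
      using that sub[of r] f_comp[of p q r] by auto
  qed
  then obtain z where z: "\<And>p. z p \<in> ?A p"
    "\<And>p q. p < q \<Longrightarrow> map_prod (f q p) (f q p) (z q) = z p" by blast
  let ?x = "\<lambda>p. fst (z p)" and ?y = "\<lambda>p. snd (z p)"
  have zs: "fst (z p) \<in> seps (S p)" "snd (z p) \<in> seps (S p)" for p
    using z(1)[of p] sub[of p] by auto
  have fz: "f q p (fst (z q)) = fst (z p)" "f q p (snd (z q)) = snd (z p)" if "p < q" for p q
    using z(2)[OF that] by (metis fst_map_prod, metis snd_map_prod)
  have "?x \<in> seps L" "?y \<in> seps L"
    using zs fz by (auto simp: mem_limit)
  moreover have "\<exists>(x', y')\<in>R p. x' p = ?x p \<and> y' p = ?y p" for p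
    using z(1)[of p] by force
  ultimately show ?thesis by (intro bexI[of _ ?x] bexI[of _ ?y] allI)
qed

lemma limit_point:
  assumes "\<And>p. R p \<subseteq> seps L" and "\<And>p q. p \<le> q \<Longrightarrow> R q \<subseteq> R p" and "\<And>p. R p \<noteq> {}"
  shows "\<exists>x\<in>seps L. \<forall>p. \<exists>y\<in>R p. y p = x p"
proof -
  let ?R = "\<lambda>p. (\<lambda>y. (y, y)) ` R p"
  have "\<exists>x\<in>seps L. \<exists>y\<in>seps L. \<forall>p. \<exists>(x', y')\<in>?R p. x' p = x p \<and> y' p = y p"
  proof (rule limit_point2)
    show "?R p \<subseteq> seps L \<times> seps L" for p using assms(1)[of p] by auto
    show "?R q \<subseteq> ?R p" if "p \<le> q" for p q using assms(2)[OF that] by (rule image_mono)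
    show "?R p \<noteq> {}" for p using assms(3) by simp
  qed
  then show ?thesis
  proof (elim bexE)
    fix x y
    assume "x \<in> seps L" and *: "\<forall>p. \<exists>(x', y')\<in>?R p. x' p = x p \<and> y' p = y p"
    moreover have "\<exists>y\<in>R p. y p = x p" for p
      using spec[OF *, of p] by auto
    ultimately show ?thesis by blast
  qed
qed

text \<open>Homomorphisms preserve degeneracy. If degenerate elements existed at arbitrarily large
  levels, they would exist at all levels, and a compatible choice of them would be a degenerate
  element of the limit.\<close>

lemma evtl_nondegenerate:
  assumes nd: "\<And>x. x \<in> seps L \<Longrightarrow> sinv L x \<noteq> x"
  shows "evtl (\<lambda>p. \<forall>a\<in>seps (S p). sinv (S p) a \<noteq> a)"
proof (rule ccontr)
  let ?A = "\<lambda>p. {a \<in> seps (S p). sinv (S p) a = a}"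
  assume not: "\<not> ?thesis"
  have maps: "f q p a \<in> ?A p" if "p < q" "a \<in> ?A q" for p q a
    using f_hom[OF that(1)] that(2) unfolding sep_hom_def by (metis (mono_tags, lifting) mem_Collect_eq)
  have "\<exists>x. (\<forall>p. x p \<in> ?A p) \<and> (\<forall>p q. p < q \<longrightarrow> f q p (x q) = x p)"
  proof (rule finite_inverse_limit_nonempty[OF directed])
    show "?A p \<noteq> {}" for p
    proof -
      obtain q a where "p \<le> q" "a \<in> ?A q" using not unfolding evtl_def by blast
      then show ?thesis using maps[of p q a] by (cases "p = q") (blast, metis empty_iff le_neq_trans)
    qed
  qed (use finite_level maps f_comp in auto)
  then obtain x where "x \<in> seps L" "sinv L x = x"
    unfolding mem_limit fun_eq_iff by auto
  then show False using nd by blast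
qed

text \<open>A witness \<open>s\<close> in the limit works at all large levels: the inequalities hold
  at every level, and \<open>s q\<close> differs from both orientations of \<open>r q\<close> from
  some level on.\<close>

lemma finitely_trivialI:
  assumes r: "r \<in> seps L" and s: "s \<in> seps L"
    and "s \<noteq> r" "s \<noteq> sinv L r" "sle L r s" "sle L r (sinv L s)"
  shows "finitely_trivial S f r"
proof -
  have "evtl (\<lambda>q. s q \<noteq> r q \<and> s q \<noteq> sinv L r q)"
    using assms by (intro evtl_conj evtl_neq lim.inv_closed)
  then have "\<exists>q\<ge>p. s q \<noteq> r q \<and> s q \<noteq> sinv L r q" for p
    by (rule evtl_above)
  moreover have "trivial_in (image_system S f q) (r q)"
    if q: "s q \<noteq> r q" "s q \<noteq> sinv L r q" for q
  proof -
    have "s q \<in> seps (S q)" "r q \<in> seps (S q)" "sle (S q) (r q) (s q)"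
      "sle (S q) (r q) (sinv (S q) (s q))"
      using assms by (auto simp: le_limit)
    moreover from this have "underlying (S q) (s q) \<noteq> underlying (S q) (r q)" "r q \<noteq> sinv (S q) (s q)"
      using q lev.underlying_eq_iff by auto
    ultimately show ?thesis
      using r s q unfolding trivial_in_def witnesses_triviality_def slt_def
      by (auto simp: image_system_def proj_def underlying_def)
  qed
  ultimately show ?thesis
    using r unfolding finitely_trivial_def by blast
qed

lemma has_inconsistent_pair_over_bond:
  assumes "has_inconsistent_pair_over S f q a" "p \<le> q"
  shows "has_inconsistent_pair_over S f p (bond q p a)"
  using assms bond_limit unfolding has_inconsistent_pair_over_def inconsistent_pair_def by metis

end

section \<open>Essentially closed families of stars and their levels\<close>

locale star_family = separation_inverse_system S f
  for S :: "'p::order \<Rightarrow> 'a sepsys" and f :: "'p \<Rightarrow> 'p \<Rightarrow> 'a \<Rightarrow> 'a" +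
  fixes F :: "('p \<Rightarrow> 'a) set set"
  assumes nondegenerate: "\<And>x. x \<in> seps L \<Longrightarrow> sinv L x \<noteq> x"
    and stars: "\<And>\<sigma>. \<sigma> \<in> F \<Longrightarrow> star L \<sigma>"
    and closed: "essentially_closed S f F"
begin

lemma closed_coreI:
  assumes "\<sigma> \<subseteq> seps L"
    and "\<And>p. \<exists>\<sigma>'\<in>F. core (S p) (proj p \<sigma>') = core (S p) (proj p \<sigma>) \<or>
           (\<exists>s. core (S p) (proj p \<sigma>') = {s p, sinv L s p} \<and> \<sigma> = {s})"
  shows "\<sigma> \<in> F"
  using assms closed unfolding essentially_closed_def by blast

lemma finitely_inconsistent_mem: "finitely_inconsistent S f x \<Longrightarrow> {x} \<in> F"
  and finitely_trivial_mem: "finitely_trivial S f r \<Longrightarrow> {sinv L r} \<in> F"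
  using closed unfolding essentially_closed_def by blast+

lemma F_sub: "\<sigma> \<in> F \<Longrightarrow> \<sigma> \<subseteq> seps L"
  using stars lim.star_subset by blast

lemma level_F_star: "\<rho> \<in> level_F S f F q \<Longrightarrow> star (S q) \<rho>"
  unfolding level_F_def level_L_def using stars star_proj by blast

text \<open>Images of projections are projections. For a star in \<open>level_L\<close> with core
  \<open>{a}\<close>, \<open>core_image_single\<close> leaves open that the image has a core of two
  elements, so the singleton of the image of \<open>a\<close> is used instead; the inconsistent pair
  over \<open>a\<close> also lies over that image.\<close>

lemma level_F_bond:
  assumes pq: "p \<le> q" and \<rho>: "\<rho> \<in> level_F S f F q"
  shows "bond q p ` \<rho> \<in> level_F S f F p \<or>
    (\<exists>a. core (S q) \<rho> = {a} \<and> {bond q p a} \<in> level_F S f F p)"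
  using \<rho> unfolding level_F_def
proof
  assume "\<rho> \<in> proj q ` F"
  then show "bond q p ` \<rho> \<in> proj p ` F \<union> level_L S f p \<or>
    (\<exists>a. core (S q) \<rho> = {a} \<and> {bond q p a} \<in> proj p ` F \<union> level_L S f p)"
    using proj_bond[OF pq] F_sub by blast
next
  assume "\<rho> \<in> level_L S f q"
  then obtain a where a: "star (S q) \<rho>" "core (S q) \<rho> = {a}" "has_inconsistent_pair_over S f q a"
    unfolding level_L_def by blast
  then have "a \<in> seps (S q)"
    using lev.star_subset lev.core_subset by blast
  then have "bond q p a \<in> seps (S p)"
    using separation_hom.hom_closed[OF bond_hom[OF pq]] by blast
  then have "{bond q p a} \<in> level_L S f p"
    using has_inconsistent_pair_over_bond[OF a(3) pq] by (simp add: level_L_def)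
  then show "bond q p ` \<rho> \<in> proj p ` F \<union> level_L S f p \<or>
    (\<exists>a. core (S q) \<rho> = {a} \<and> {bond q p a} \<in> proj p ` F \<union> level_L S f p)"
    using a by blast
qed

lemma ex_compatible_families:
  assumes levels: "\<And>p. \<exists>\<tau>. \<tau> \<subseteq> seps (S p) \<and> nested (S p) \<tau> \<and>
                       essentially_over (S p) \<tau> (level_F S f F p)"
  shows "\<exists>N. (\<forall>p. lev.sym_subset p (N p) \<and> nested (S p) (N p)) \<and>
    evtl (\<lambda>p. (\<forall>a\<in>seps (S p). sinv (S p) a \<noteq> a) \<and> essentially_over (S p) (N p) (level_F S f F p)) \<and>
    (\<forall>p q. p < q \<longrightarrow> f q p ` N q = N p)"
proof -
  obtain p0 where p0: "\<And>q a. p0 \<le> q \<Longrightarrow> a \<in> seps (S q) \<Longrightarrow> sinv (S q) a \<noteq> a"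
    using evtl_nondegenerate[OF nondegenerate] unfolding evtl_def by blast
  \<comment> \<open>Only levels from \<open>p0\<close> on are required to be essentially over,
    because \<open>essentially_over_image\<close> needs an image without degenerate
    elements.\<close>
  define A where "A = (\<lambda>p. {T. lev.sym_subset p T \<and> nested (S p) T \<and>
    (p0 \<le> p \<longrightarrow> essentially_over (S p) T (level_F S f F p))})"
  have "\<exists>N. (\<forall>p. N p \<in> A p) \<and> (\<forall>p q. p < q \<longrightarrow> f q p ` N q = N p)"
  proof (rule finite_inverse_limit_nonempty[OF directed])
    fix p
    have "A p \<subseteq> Pow (seps (S p))"
      by (auto simp: A_def lev.sym_subset_def)
    then show "finite (A p)"
      using finite_level finite_subset by blast
    obtain \<tau> where \<tau>: "\<tau> \<subseteq> seps (S p)" "nested (S p) \<tau>" "essentially_over (S p) \<tau> (level_F S f F p)"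
      using levels by blast
    \<comment> \<open>Adding all inverses leaves the generated subsystem, and with it the splitting
      stars, unchanged.\<close>
    have "lev.sym_subset p (\<tau> \<union> sinv (S p) ` \<tau>)"
      using \<tau>(1) lev.inv_inv by (force simp: lev.sym_subset_def)
    moreover have "nested (S p) (\<tau> \<union> sinv (S p) ` \<tau>)"
      using lev.nested_symmetrize \<tau> by blast
    moreover have "essentially_over (S p) (\<tau> \<union> sinv (S p) ` \<tau>) (level_F S f F p)"
      using \<tau>(3) lev.splitting_star_symmetrize[OF \<tau>(1)] unfolding essentially_over_def by simp
    ultimately show "A p \<noteq> {}"
      by (auto simp: A_def)
  next
    fix p q T
    assume pq: "p < q" and T: "T \<in> A q"
    interpret separation_hom "S q" "S p" "bond q p"
      using bond_hom pq by simp
    have fb: "bond q p = f q p" using pq by (auto simp: bond_def)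
    have T': "lev.sym_subset q T" "T \<subseteq> seps (S q)" "nested (S q) T"
      using T by (auto simp: A_def lev.sym_subset_def)
    have "essentially_over (S p) (bond q p ` T) (level_F S f F p)" if "p0 \<le> p"
    proof (rule essentially_over_image[OF finite_level T'(1,3)])
      show "essentially_over (S q) T (level_F S f F q)"
        using T that pq by (auto simp: A_def)
      show "sinv (S p) y \<noteq> y" if "y \<in> bond q p ` T" for y
        using that p0[OF \<open>p0 \<le> p\<close>] T'(2) by auto
    qed (use level_F_star level_F_bond pq in auto)
    then show "f q p ` T \<in> A p"
      using sym_subset_image[OF T'(1)] nested_image[OF T'(3,2)] by (simp add: A_def fb)
  next
    fix p q r T
    assume "p < q" "q < r" "T \<in> A r"
    moreover from this have "T \<subseteq> seps (S r)" by (simp add: A_def lev.sym_subset_def)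
    ultimately show "f r p ` T = f q p ` f r q ` T"
      unfolding image_image using f_comp by (intro image_cong) auto
  qed
  then obtain N where N: "\<And>p. N p \<in> A p" "\<forall>p q. p < q \<longrightarrow> f q p ` N q = N p"
    by blast
  moreover have "evtl (\<lambda>p. (\<forall>a\<in>seps (S p). sinv (S p) a \<noteq> a) \<and>
      essentially_over (S p) (N p) (level_F S f F p))"
    unfolding evtl_def using N(1) p0 by (auto simp: A_def)
  ultimately show ?thesis
    by (auto simp: A_def)
qed

text \<open>Either every level has an inconsistent pair over \<open>x p\<close>, and
  \<open>x\<close> is finitely inconsistent, or no large level has one. In the second case \<rho>
  cannot come from \<open>level_L\<close>, so it is the projection of a member of \<open>F\<close>,
  and the core condition for closedness can be checked.\<close>

lemma singleton_mem:
  assumes x: "x \<in> seps L"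
    and ev: "evtl (\<lambda>q. \<exists>\<rho>\<in>level_F S f F q.
      core (S q) \<rho> = {x q} \<or> core (S q) \<rho> = {x q, sinv (S q) (x q)})"
  shows "{x} \<in> F"
proof -
  have "(\<forall>p. has_inconsistent_pair_over S f p (x p)) \<or>
      evtl (\<lambda>p. \<not> has_inconsistent_pair_over S f p (x p))"
    using has_inconsistent_pair_over_bond bond_limit[OF x] by (intro all_or_evtl_not) metis
  then show ?thesis
  proof
    assume "\<forall>p. has_inconsistent_pair_over S f p (x p)"
    then show ?thesis
      using x by (intro finitely_inconsistent_mem) (simp add: finitely_inconsistent_def)
  next
    assume "evtl (\<lambda>p. \<not> has_inconsistent_pair_over S f p (x p))"
    note good = evtl_above[OF evtl_conj[OF ev this]]
    show ?thesis
    proof (rule closed_coreI)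
      fix p
      obtain q \<rho> where q: "p \<le> q" and \<rho>: "\<rho> \<in> level_F S f F q"
        "core (S q) \<rho> = {x q} \<or> core (S q) \<rho> = {x q, sinv (S q) (x q)}"
        and nh: "\<not> has_inconsistent_pair_over S f q (x q)"
        using good[of p] by blast
      have "\<rho> \<notin> level_L S f q"
        using \<rho>(2) nh unfolding level_L_def by auto
      then obtain \<sigma>' where \<sigma>': "\<sigma>' \<in> F" "\<rho> = proj q \<sigma>'"
        using \<rho>(1) unfolding level_F_def by blast
      interpret separation_hom "S q" "S p" "bond q p"
        using bond_hom q by simp
      \<comment> \<open>The two outcomes match the two alternatives in the first closedness
        condition, the second one with \<open>s = x\<close>.\<close>
      have "core (S p) (proj p \<sigma>') = {x p} \<or> core (S p) (proj p \<sigma>') = {x p, sinv (S p) (x p)}"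
        using core_image_single[OF level_F_star[OF \<rho>(1)] _ \<rho>(2)] \<sigma>' finite_proj F_sub
          proj_bond[OF q] bond_limit[OF x q] by simp
      moreover have "core (S p) (proj p {x}) = {x p}"
        using x by (simp add: proj_def)
      ultimately show "\<exists>\<sigma>'\<in>F. core (S p) (proj p \<sigma>') = core (S p) (proj p {x}) \<or>
          (\<exists>s. core (S p) (proj p \<sigma>') = {s p, sinv L s p} \<and> {x} = {s})"
        using \<sigma>'(1) by auto
    qed (use x in simp)
  qed
qed

end

section \<open>The closed nested set obtained from compatible level sets\<close>

locale compatible_families = star_family S f F
  for S :: "'p::order \<Rightarrow> 'a sepsys" and f :: "'p \<Rightarrow> 'p \<Rightarrow> 'a \<Rightarrow> 'a"
    and F :: "('p \<Rightarrow> 'a) set set" +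
  fixes N :: "'p \<Rightarrow> 'a set"
  assumes N_sym: "\<And>p. lev.sym_subset p (N p)"
    and N_nested: "\<And>p. nested (S p) (N p)"
    and N_maps: "\<And>p q. p < q \<Longrightarrow> f q p ` N q = N p"
    and N_over: "evtl (\<lambda>p. (\<forall>a\<in>seps (S p). sinv (S p) a \<noteq> a) \<and>
      essentially_over (S p) (N p) (level_F S f F p))"
begin

definition T :: "('p \<Rightarrow> 'a) set" where
  "T = {x \<in> seps L. \<forall>p. x p \<in> N p}"

lemma N_sub: "N p \<subseteq> seps (S p)" and N_inv: "a \<in> N p \<Longrightarrow> sinv (S p) a \<in> N p"
  using N_sym unfolding lev.sym_subset_def by auto

lemma T_sub: "T \<subseteq> seps L"
  by (auto simp: T_def)

lemma T_inv: "x \<in> T \<Longrightarrow> sinv L x \<in> T"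
  using N_inv by (simp add: T_def lim.inv_closed)

lemma T_sym: "lim.sym_subset T"
  using T_sub T_inv by (auto simp: lim.sym_subset_def)

text \<open>The bonding maps between the sets \<open>N p\<close> are surjective, and by compactness
  this carries over to the projections of \<open>T\<close>.\<close>

lemma ex_T_above:
  assumes a: "a \<in> N p"
  shows "\<exists>x\<in>T. x p = a"
proof -
  \<comment> \<open>Only the levels \<open>q \<ge> p\<close> are constrained. At any other level
    nonemptiness is inherited from a common upper bound of \<open>p\<close> and
    \<open>q\<close>.\<close>
  let ?A = "\<lambda>q. {b \<in> N q. (q = p \<longrightarrow> b = a) \<and> (p < q \<longrightarrow> f q p b = a)}"
  have "\<exists>x. (\<forall>q. x q \<in> ?A q) \<and> (\<forall>q r. q < r \<longrightarrow> f r q (x r) = x q)"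
  proof (rule finite_inverse_limit_nonempty[OF directed])
    show "finite (?A q)" for q
      using finite_subset[OF N_sub finite_level] by simp
    have maps: "f r q b \<in> ?A q" if qr: "q < r" and b: "b \<in> ?A r" for q r b
    proof -
      have "b \<in> seps (S r)" "f r q b \<in> N q" using b N_sub N_maps[OF qr] by auto
      then show ?thesis using b qr f_comp[of p q r b] by auto
    qed
    then show "f r q b \<in> ?A q" if "q < r" "b \<in> ?A r" for q r b
      using that by blast
    show "?A q \<noteq> {}" for q
    proof -
      obtain r where r: "p \<le> r" "q \<le> r" using directed by blast
      have "?A r \<noteq> {}"
      proof (cases "p = r")
        case False
        then have "p < r" using r by simp
        then obtain b where "b \<in> N r" "f r p b = a"
          using N_maps[OF \<open>p < r\<close>] a by (metis imageE)
        then show ?thesis using \<open>p < r\<close> by auto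
      qed (use a in auto)
      then show ?thesis
        using maps[of q r] r(2) by (cases "q = r") (blast, metis (no_types, lifting) ex_in_conv le_neq_trans)
    qed
    show "f s q b = f r q (f s r b)" if "q < r" "r < s" "b \<in> ?A s" for q r s b
      using that f_comp N_sub by blast
  qed
  then obtain x where x: "\<And>q. x q \<in> ?A q" "\<And>q r. q < r \<Longrightarrow> f r q (x r) = x q"
    by blast
  have "x \<in> T"
    unfolding T_def mem_limit using x N_sub by (simp add: subset_iff)
  moreover have "x p = a" using x(1)[of p] by simp
  ultimately show ?thesis by blast
qed

text \<open>Each of the four comparisons that fails in the limit fails at all large levels, so two
  crossing elements would already cross in some \<open>N q\<close>.\<close>

lemma T_nested: "nested L T"
proof (rule lim.nestedI[OF T_sub], rule ccontr)
  fix r s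
  assume T: "r \<in> T" "s \<in> T"
  assume not: "\<not> (sle L r s \<or> sle L s r \<or> sle L r (sinv L s) \<or> sle L (sinv L r) s)"
  have rs: "r \<in> seps L" "s \<in> seps L" using T T_sub by auto
  then have "evtl (\<lambda>q. \<not> sle (S q) (r q) (s q) \<and> \<not> sle (S q) (s q) (r q) \<and>
      \<not> sle (S q) (r q) (sinv L s q) \<and> \<not> sle (S q) (sinv L r q) (s q))"
    using not evtl_not_le[of r s] evtl_not_le[of s r] evtl_not_le[of r "sinv L s"]
      evtl_not_le[of "sinv L r" s] by (intro evtl_conj) simp_all
  then obtain q where "\<not> sle (S q) (r q) (s q) \<and> \<not> sle (S q) (s q) (r q) \<and>
      \<not> sle (S q) (r q) (sinv (S q) (s q)) \<and> \<not> sle (S q) (sinv (S q) (r q)) (s q)"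
    unfolding evtl_def by auto
  moreover have "r q \<in> N q" "s q \<in> N q" using T by (auto simp: T_def)
  ultimately show False
    using lev.nested_cases[OF N_nested N_sub] by blast
qed

lemma T_closed: "closedin (limit_topology S f) T"
proof -
  have "closedin (product_topology (\<lambda>p. discrete_topology (seps (S p))) UNIV) (PiE UNIV N)"
    using N_sub by (subst closedin_product_topology) auto
  then have "closedin (limit_topology S f) (PiE UNIV N \<inter> seps L)"
    unfolding limit_topology_def closedin_subtopology by blast
  moreover have "PiE UNIV N \<inter> seps L = T"
    by (auto simp: T_def)
  ultimately show ?thesis by simp
qed

lemma T_splits: "splitting_star L T \<sigma> \<longleftrightarrow> (\<exists>Q. lim.splits T Q \<sigma>)"
  using lim.splitting_star_iff[OF T_sym] nondegenerate T_sub by blast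

text \<open>The form in which the level hypothesis is applied: by finiteness a consistent
  orientation of \<open>N q\<close> automatically lies below its maximal elements.\<close>

lemma level_splits:
  assumes good: "\<forall>a\<in>seps (S q). sinv (S q) a \<noteq> a" "essentially_over (S q) (N q) (level_F S f F q)"
    and R: "R \<subseteq> N q" "\<And>x. x \<in> N q \<Longrightarrow> x \<in> R \<longleftrightarrow> sinv (S q) x \<notin> R"
      "\<And>r s. r \<in> R \<Longrightarrow> s \<in> R \<Longrightarrow> sle (S q) (sinv (S q) r) s \<Longrightarrow> r = s"
  shows "\<exists>\<rho>\<in>level_F S f F q. maximal_elements (S q) R = core (S q) \<rho> \<or>
      (\<exists>s\<in>seps (S q). maximal_elements (S q) R = {s} \<and> core (S q) \<rho> = {s, sinv (S q) s})"
proof -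
  have "finite R" using R(1) N_sub finite_level finite_subset by metis
  then have "lev.splits q (N q) R (maximal_elements (S q) R)"
    using R N_sub by (intro lev.splits_finiteI) auto
  then have "splitting_star (S q) (N q) (maximal_elements (S q) R)"
    using lev.splitting_star_iff[OF N_sym] good(1) N_sub by blast
  then show ?thesis
    using good(2) unfolding essentially_over_def by blast
qed

end

section \<open>Splitting stars of the limit\<close>

context compatible_families
begin

lemma cosmall_split_mem:
  assumes sp: "lim.splits T Q \<sigma>" and x: "x \<in> \<sigma>" "sle L (sinv L x) x"
  shows "\<sigma> \<in> F"
proof -
  have \<sigma>: "\<sigma> = {x}" and le: "\<And>y. y \<in> Q \<Longrightarrow> sle L y x"
    using lim.splits_cosmall[OF sp T_nested T_sub x] by auto
  have Q: "x \<in> Q" "Q \<subseteq> T" "\<And>y. y \<in> T \<Longrightarrow> y \<in> Q \<longleftrightarrow> sinv L y \<notin> Q"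
    using sp x lim.mem_maximal_elements unfolding lim.splits_def by auto
  have xL: "x \<in> seps L" "x \<in> T" using Q T_sub by auto
  show ?thesis
  proof (cases "finitely_trivial S f (sinv L x)")
    case True
    then show ?thesis using finitely_trivial_mem[OF True] \<sigma> xL by simp
  next
    case False
    then have "evtl (\<lambda>q. \<not> trivial_in (image_system S f q) (sinv (S q) (x q)))"
      using xL unfolding finitely_trivial_def evtl_def by auto
    then have "evtl (\<lambda>q. \<exists>\<rho>\<in>level_F S f F q.
      core (S q) \<rho> = {x q} \<or> core (S q) \<rho> = {x q, sinv (S q) (x q)})"
    proof (rule evtl_mono[OF evtl_conj[OF N_over]], elim conjE)
      fix q
      assume nd: "\<forall>a\<in>seps (S q). sinv (S q) a \<noteq> a"
        and ov: "essentially_over (S q) (N q) (level_F S f F q)"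
        and nt: "\<not> trivial_in (image_system S f q) (sinv (S q) (x q))"
      define a where "a = x q"
      have a: "a \<in> N q" "a \<in> seps (S q)" "sinv (S q) a \<noteq> a" "sle (S q) (sinv (S q) a) a"
        using xL nd x(2) by (auto simp: a_def T_def le_limit)
      \<comment> \<open>Orients \<open>N q\<close> towards \<open>a\<close>. Both orientations of
        \<open>a\<close> lie below \<open>a\<close>, so its inverse is excluded explicitly.\<close>
      define R where "R = {b \<in> N q. sle (S q) b a \<and> b \<noteq> sinv (S q) a}"
      \<comment> \<open>Lift \<open>b\<close> to \<open>y\<close> in \<open>T\<close>: one of
        \<open>y\<close> and its inverse is in \<open>Q\<close>, hence below
        \<open>x\<close>.\<close>
      have some: "sle (S q) b a \<or> sle (S q) (sinv (S q) b) a" if b: "b \<in> N q" for b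
      proof -
        obtain y where y: "y \<in> T" "y q = b" using ex_T_above b by blast
        then have "sle L y x \<or> sle L (sinv L y) x" using Q le by blast
        then show ?thesis using y by (auto simp: le_limit a_def)
      qed
      \<comment> \<open>Otherwise the inverse of \<open>a\<close> lies strictly below both
        orientations of \<open>b\<close>, so \<open>b\<close> witnesses its triviality at level
        \<open>q\<close>. The witness counts in the image system because it lifts to
        \<open>T\<close>.\<close>
      have notboth: "b = a \<or> b = sinv (S q) a"
        if b: "b \<in> N q" "sle (S q) b a" "sle (S q) (sinv (S q) b) a" for b
      proof (rule ccontr)
        assume *: "\<not> ?thesis"
        have bS: "b \<in> seps (S q)" using b N_sub by blast
        obtain y where "y \<in> T" "y q = b" using ex_T_above b by blast
        then have "b \<in> seps (image_system S f q)" using T_sub by (auto simp: image_system_def proj_def)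
        moreover have "sinv (S q) a \<in> seps (image_system S f q)"
          using lim.inv_closed[OF xL(1)]
          by (auto simp: image_system_def proj_def a_def intro!: image_eqI[of _ _ "sinv L x"])
        moreover have "underlying (S q) b \<noteq> underlying (S q) (sinv (S q) a)"
          using * bS a lev.underlying_eq_iff by auto
        moreover have "sle (S q) (sinv (S q) a) b" "sle (S q) (sinv (S q) a) (sinv (S q) b)"
          using b bS a lev.inv_le_swap by auto
        moreover have "sinv (S q) a \<noteq> b" "sinv (S q) a \<noteq> sinv (S q) b"
          using * bS a lev.inv_inv by metis+
        ultimately have "trivial_in (image_system S f q) (sinv (S q) a)"
          unfolding trivial_in_def witnesses_triviality_def slt_def underlying_def
          by (auto simp: image_system_def)
        then show False using nt by (simp add: a_def)
      qed
      have Rsub: "R \<subseteq> N q" by (auto simp: R_def)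
      have Ror: "b \<in> R \<longleftrightarrow> sinv (S q) b \<notin> R" if b: "b \<in> N q" for b
      proof -
        have bS: "b \<in> seps (S q)" "sinv (S q) b \<in> N q" using b N_sub N_inv by auto
        consider "b = a" | "b = sinv (S q) a" | "b \<noteq> a" "b \<noteq> sinv (S q) a" by blast
        then show ?thesis
        proof cases
          case 1
          then show ?thesis using a by (auto simp: R_def lev.refl)
        next
          case 2
          then show ?thesis using a by (auto simp: R_def lev.refl)
        next
          case 3
          then have "sinv (S q) b \<noteq> sinv (S q) a" using a bS lev.inv_inv by metis
          then show ?thesis using some[OF b] notboth[OF b] bS b 3 by (auto simp: R_def)
        qed
      qed
      \<comment> \<open>Through \<open>s\<close>, the inverse of \<open>r\<close> lies below
        \<open>a\<close>, as \<open>r\<close> itself does; \<open>notboth\<close> leaves only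
        \<open>a\<close>. Exchanging the roles gives \<open>s = a\<close>.\<close>
      have eq: "r = a" if "r \<in> R" "s \<in> R" "sle (S q) (sinv (S q) r) s" for r s
      proof -
        have "r \<in> seps (S q)" "s \<in> seps (S q)" using that N_sub by (auto simp: R_def)
        then have "sle (S q) (sinv (S q) r) a"
          using lev.trans[OF that(3), of a] that(2) a by (simp add: R_def)
        then show ?thesis using notboth[of r] that(1) by (auto simp: R_def)
      qed
      have Rcon: "r = s" if "r \<in> R" "s \<in> R" "sle (S q) (sinv (S q) r) s" for r s
      proof -
        have "r \<in> seps (S q)" "s \<in> seps (S q)" using that N_sub by (auto simp: R_def)
        then have "sle (S q) (sinv (S q) s) r" using that(3) lev.inv_le_swap by simp
        then show ?thesis using eq that by metis
      qed
      have "maximal_elements (S q) R = {a}"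
      proof -
        have "a \<in> R" using a by (auto simp: R_def lev.refl)
        moreover have "b = a" if "b \<in> R" "sle (S q) a b" for b
          using that lev.antisym[of q a b] N_sub a by (auto simp: R_def subset_iff)
        ultimately show ?thesis
          unfolding set_eq_iff lev.mem_maximal_elements by (auto simp: R_def)
      qed
      then show "\<exists>\<rho>\<in>level_F S f F q.
        core (S q) \<rho> = {x q} \<or> core (S q) \<rho> = {x q, sinv (S q) (x q)}"
        using level_splits[OF nd ov Rsub Ror Rcon] by (auto simp: a_def)
    qed
    then show ?thesis using singleton_mem xL \<sigma> by blast
  qed
qed

end

section \<open>Splitting stars without co-small elements\<close>

locale split_without_cosmall = compatible_families S f F N
  for S :: "'p::order \<Rightarrow> 'a sepsys" and f :: "'p \<Rightarrow> 'p \<Rightarrow> 'a \<Rightarrow> 'a"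
    and F :: "('p \<Rightarrow> 'a) set set" and N :: "'p \<Rightarrow> 'a set" +
  fixes Q \<sigma> :: "('p \<Rightarrow> 'a) set"
  assumes splits: "lim.splits T Q \<sigma>"
    and not_cosmall: "\<And>x. x \<in> \<sigma> \<Longrightarrow> \<not> sle L (sinv L x) x"
begin

lemma Q_sub: "Q \<subseteq> T" "Q \<subseteq> seps L"
  using splits T_sub unfolding lim.splits_def by auto

lemma Q_orient: "y \<in> T \<Longrightarrow> y \<in> Q \<longleftrightarrow> sinv L y \<notin> Q"
  using splits unfolding lim.splits_def by auto

lemma Q_consistent: "r \<in> Q \<Longrightarrow> s \<in> Q \<Longrightarrow> sle L (sinv L r) s \<Longrightarrow> r = s"
  using splits unfolding lim.splits_def by auto

lemma Q_below: "y \<in> Q \<Longrightarrow> \<exists>s\<in>\<sigma>. sle L y s"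
  using splits unfolding lim.splits_def by auto

lemma \<sigma>_sub: "\<sigma> \<subseteq> Q" "\<sigma> \<subseteq> seps L"
  using splits Q_sub lim.mem_maximal_elements unfolding lim.splits_def by auto

lemma \<sigma>_maximal: "s \<in> \<sigma> \<Longrightarrow> y \<in> Q \<Longrightarrow> sle L s y \<Longrightarrow> s = y"
  using splits lim.mem_maximal_elements unfolding lim.splits_def by auto

lemma \<sigma>_star: "star L \<sigma>"
  using lim.splits_star[OF splits T_nested T_sub] .

lemma Q_not_cosmall: "y \<in> Q \<Longrightarrow> \<not> sle L (sinv L y) y"
  using Q_below not_cosmall lim.cosmall_mono Q_sub \<sigma>_sub by (metis subsetD)

text \<open>Membership in the topological closure: by directedness, fixing a single coordinate
  already gives a neighbourhood base in the limit.\<close>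

definition adherent :: "('p \<Rightarrow> 'a) set \<Rightarrow> ('p \<Rightarrow> 'a) \<Rightarrow> bool" where
  "adherent A x \<longleftrightarrow> x \<in> seps L \<and> (\<forall>p. \<exists>y\<in>A. y p = x p)"

lemma adherent_T: "adherent A x \<Longrightarrow> A \<subseteq> T \<Longrightarrow> x \<in> T"
proof -
  assume A: "adherent A x" "A \<subseteq> T"
  have "x p \<in> N p" for p
  proof -
    obtain y where "y \<in> A" "y p = x p" using A(1) unfolding adherent_def by blast
    moreover have "y p \<in> N p" using \<open>y \<in> A\<close> A(2) unfolding T_def by blast
    ultimately show ?thesis by simp
  qed
  then show "x \<in> T" using A(1) by (simp add: adherent_def T_def)
qed

text \<open>If \<open>z\<close> is not in \<open>Q\<close>, its inverse is. Elements of \<sigma>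
  agreeing with \<open>z\<close> at large levels put every \<open>y\<close> in \<sigma> below the
  inverse of \<open>z\<close>, so maximality leaves that inverse as the only element of \<sigma>;
  adherence then makes \<open>z\<close> degenerate.\<close>

lemma adherent_\<sigma>:
  assumes z: "adherent \<sigma> z"
  shows "z \<in> Q"
proof (rule ccontr)
  assume "z \<notin> Q"
  have zT: "z \<in> T" "z \<in> seps L"
    using adherent_T[OF z] \<sigma>_sub Q_sub z by (auto simp: adherent_def)
  then have iz: "sinv L z \<in> Q" using Q_orient \<open>z \<notin> Q\<close> by blast
  have "y = sinv L z" if y: "y \<in> \<sigma>" for y
  proof -
    have yL: "y \<in> seps L" "y \<noteq> z" using y \<sigma>_sub \<open>z \<notin> Q\<close> by auto
    have "sle (S p) (y p) (sinv L z p)" for p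
    proof -
      obtain q where q: "p \<le> q" "y q \<noteq> z q"
        using evtl_above[OF evtl_neq[OF yL(2,1) zT(2)]] by blast
      obtain y' where y': "y' \<in> \<sigma>" "y' q = z q" using z unfolding adherent_def by blast
      then have "sle L y (sinv L y')"
        using lim.starD[OF \<sigma>_star y y'(1)] q(2) by metis
      then have "sle (S q) (y q) (sinv L z q)" using y'(2) by (metis inv_limit_apply le_limit)
      then show ?thesis
        using le_below q(1) yL zT lim.inv_closed by blast
    qed
    then have "sle L y (sinv L z)" by (simp add: le_limit)
    then show ?thesis using \<sigma>_maximal y iz by blast
  qed
  moreover obtain y where "y \<in> \<sigma>" using z unfolding adherent_def by blast
  ultimately have "\<sigma> = {sinv L z}" by blast
  then have "z p = sinv L z p" for p
    using z unfolding adherent_def by fastforce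
  then show False using nondegenerate zT by (metis ext)
qed

lemma adherent_Q:
  assumes z: "adherent Q z"
  shows "z \<in> Q"
proof (rule ccontr)
  assume "z \<notin> Q"
  have zT: "z \<in> T" "z \<in> seps L"
    using adherent_T[OF z] Q_sub z by (auto simp: adherent_def)
  then have iz: "sinv L z \<in> Q" using Q_orient \<open>z \<notin> Q\<close> by blast
  then obtain s where s: "s \<in> \<sigma>" "sle L (sinv L z) s" using Q_below by blast
  have sL: "s \<in> seps L" "s \<in> Q" using s \<sigma>_sub by auto
  have sz: "sle L (sinv L s) z" using s(2) lim.inv_le_swap zT sL by simp
  \<comment> \<open>Tests whether \<open>z\<close> is below \<open>s\<close> level by level. If it
    always is, \<open>s\<close> is co-small. If it fails at large levels, elements of
    \<open>Q\<close> approximating \<open>z\<close> lie below other elements \<open>t\<close> of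
    \<sigma>, squeezed onto the inverse of \<open>s\<close>, which would then be adherent to
    \<sigma>.\<close>
  define D where "D = (\<lambda>p. \<exists>y\<in>Q. y p = z p \<and> sle (S p) (y p) (s p))"
  have "(\<forall>p. D p) \<or> evtl (\<lambda>p. \<not> D p)"
  proof (rule all_or_evtl_not)
    fix p q
    assume pq: "p \<le> q" and "D q"
    then obtain y where y: "y \<in> Q" "y q = z q" "sle (S q) (y q) (s q)" unfolding D_def by blast
    then have "y \<in> seps L" using Q_sub by blast
    then show "D p"
      using eq_below[of y q z p] le_below[of q y s p] pq y zT sL unfolding D_def by blast
  qed
  then show False
  proof
    assume "\<forall>p. D p"
    then have "sle L z s" unfolding D_def le_limit by metis
    then have "sle L (sinv L s) s" using sz lim.trans sL zT lim.inv_closed by blast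
    then show False using not_cosmall s by blast
  next
    assume nD: "evtl (\<lambda>p. \<not> D p)"
    have "adherent \<sigma> (sinv L s)"
      unfolding adherent_def
    proof (intro conjI allI)
      show "sinv L s \<in> seps L" using sL by simp
      fix p
      obtain q where q: "p \<le> q" "\<not> D q" using evtl_above[OF nD] by blast
      obtain y where y: "y \<in> Q" "y q = z q" using z unfolding adherent_def by blast
      then have "\<not> sle L y s" using q(2) unfolding D_def le_limit by blast
      obtain t where t: "t \<in> \<sigma>" "sle L y t" using Q_below y by blast
      then have "sle L t (sinv L s)"
        using lim.starD[OF \<sigma>_star t(1) s(1)] \<open>\<not> sle L y s\<close> by blast
      then have le: "sle (S p) (t p) (sinv (S p) (s p))" by (simp add: le_limit)
      have mem: "y \<in> seps L" "t \<in> seps L" using y Q_sub t \<sigma>_sub by auto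
      have "y p = z p" using eq_below[of y q z p] y(2) q(1) mem zT by blast
      then have "sle (S p) (z p) (t p)" "sle (S p) (sinv (S p) (s p)) (z p)"
        using t(2) sz unfolding le_limit by (metis, metis inv_limit_apply)
      \<comment> \<open>At level \<open>p\<close> the inverse of \<open>s\<close> is below
        \<open>z\<close>, which agrees with \<open>y\<close> there, and \<open>y\<close> is below
        \<open>t\<close>; the star inequality supplies the other direction.\<close>
      then have "sle (S p) (sinv (S p) (s p)) (t p)"
        using lev.trans sL mem zT by (meson lev.inv_closed limit_apply)
      then have "t p = sinv (S p) (s p)"
        using lev.antisym[OF le] mem sL by simp
      then show "\<exists>y\<in>\<sigma>. y p = sinv L s p" using t by auto
    qed
    then have "sinv L s \<in> Q" by (rule adherent_\<sigma>)
    then show False using Q_orient sL Q_sub by blast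
  qed
qed

text \<open>Otherwise limit points \<open>x\<close>, \<open>y\<close> of the violating pairs exist.
  They lie in \<open>Q\<close> since \<open>Q\<close> is topologically closed, and consistency makes
  them one co-small element of \<open>Q\<close>.\<close>

lemma evtl_separated: "evtl (\<lambda>p. \<not> (\<exists>r\<in>Q. \<exists>s\<in>Q. sle (S p) (sinv (S p) (r p)) (s p)))"
proof -
  define R where "R = (\<lambda>p. {(r, s). r \<in> Q \<and> s \<in> Q \<and> sle (S p) (sinv L r p) (s p)})"
  have RQ: "R p \<subseteq> Q \<times> Q" for p by (auto simp: R_def)
  have anti: "R q \<subseteq> R p" if "p \<le> q" for p q
    using le_below[OF _ that] Q_sub(2) lim.inv_closed unfolding R_def by blast
  have "(\<forall>p. R p \<noteq> {}) \<or> evtl (\<lambda>p. \<not> R p \<noteq> {})"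
    using anti by (intro all_or_evtl_not) blast
  moreover have False if ne: "\<forall>p. R p \<noteq> {}"
  proof -
    have "\<exists>x\<in>seps L. \<exists>y\<in>seps L. \<forall>p. \<exists>(x', y')\<in>R p. x' p = x p \<and> y' p = y p"
    proof (rule limit_point2)
      show "R p \<subseteq> seps L \<times> seps L" for p using RQ Q_sub(2) by blast
    qed (use anti ne in auto)
    then obtain x y where xy: "x \<in> seps L" "y \<in> seps L"
      and *: "\<forall>p. \<exists>(x', y')\<in>R p. x' p = x p \<and> y' p = y p" by (elim bexE)
    have **: "\<exists>x'\<in>Q. \<exists>y'\<in>Q. x' p = x p \<and> y' p = y p \<and> sle (S p) (sinv (S p) (x' p)) (y' p)" for p
      using spec[OF *, of p] by (auto simp: R_def)
    then have "x \<in> Q" "y \<in> Q"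
      using adherent_Q xy unfolding adherent_def by meson+
    moreover have "sle L (sinv L x) y"
      using ** unfolding le_limit inv_limit_apply by metis
    ultimately show False using Q_consistent Q_not_cosmall by metis
  qed
  ultimately have "evtl (\<lambda>p. \<not> R p \<noteq> {})" by blast
  then show ?thesis by (rule evtl_mono) (auto simp: R_def)
qed

lemma core_proj:
  assumes sep: "\<not> (\<exists>r\<in>Q. \<exists>s\<in>Q. sle (S p) (sinv (S p) (r p)) (s p))"
  shows "core (S p) (proj p \<sigma>) = maximal_elements (S p) (proj p Q)"
proof -
  have "core (S p) (proj p \<sigma>) = maximal_elements (S p) (proj p \<sigma>)"
    using sep \<sigma>_sub by (intro lev.core_without_cosmall star_proj \<sigma>_star) (auto simp: proj_def)
  also have "\<dots> = maximal_elements (S p) (proj p Q)"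
  proof -
    have "\<exists>c\<in>proj p \<sigma>. sle (S p) b c" if "b \<in> proj p Q" for b
      using that Q_below unfolding proj_def le_limit by blast
    moreover have "proj p \<sigma> \<subseteq> proj p Q" "proj p Q \<subseteq> seps (S p)"
      using \<sigma>_sub Q_sub by (auto simp: proj_def)
    ultimately show ?thesis
      unfolding set_eq_iff lev.mem_maximal_elements using lev.trans lev.antisym
      by (smt (verit, ccfv_threshold) subset_iff)
  qed
  finally show ?thesis .
qed

text \<open>At separated levels \<open>Q\<close> projects to an orientation of \<open>N p\<close>:
  lifting to \<open>T\<close> shows that one orientation is hit, separation that not both are.
  Consistency holds because no pair of elements meets its premise.\<close>

lemma evtl_level_F:
  "evtl (\<lambda>p. \<exists>\<rho>\<in>level_F S f F p. core (S p) (proj p \<sigma>) = core (S p) \<rho> \<or>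
     (\<exists>s\<in>seps (S p). core (S p) (proj p \<sigma>) = {s} \<and> core (S p) \<rho> = {s, sinv (S p) s}))"
proof (rule evtl_mono[OF evtl_conj[OF N_over evtl_separated]], elim conjE)
  fix p
  assume good: "\<forall>a\<in>seps (S p). sinv (S p) a \<noteq> a" "essentially_over (S p) (N p) (level_F S f F p)"
    and sep: "\<not> (\<exists>r\<in>Q. \<exists>s\<in>Q. sle (S p) (sinv (S p) (r p)) (s p))"
  show "\<exists>\<rho>\<in>level_F S f F p. core (S p) (proj p \<sigma>) = core (S p) \<rho> \<or>
     (\<exists>s\<in>seps (S p). core (S p) (proj p \<sigma>) = {s} \<and> core (S p) \<rho> = {s, sinv (S p) s})"
    unfolding core_proj[OF sep]
  proof (rule level_splits[OF good])
    show "proj p Q \<subseteq> N p" using Q_sub by (auto simp: proj_def T_def)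
    show "r = s" if "r \<in> proj p Q" "s \<in> proj p Q" "sle (S p) (sinv (S p) r) s" for r s
      using that sep by (auto simp: proj_def)
    show "b \<in> proj p Q \<longleftrightarrow> sinv (S p) b \<notin> proj p Q" if b: "b \<in> N p" for b
    proof -
      obtain y where y: "y \<in> T" "y p = b" using ex_T_above b by blast
      have bS: "b \<in> seps (S p)" using b N_sub by blast
      have "b \<in> proj p Q \<or> sinv (S p) b \<in> proj p Q"
      proof (cases "y \<in> Q")
        case False
        then have "sinv L y \<in> Q" using Q_orient[OF y(1)] by blast
        then have "sinv L y p \<in> proj p Q" unfolding proj_def by blast
        then show ?thesis using y(2) by simp
      qed (use y(2) in \<open>auto simp: proj_def\<close>)
      moreover have "\<not> (b \<in> proj p Q \<and> sinv (S p) b \<in> proj p Q)"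
      proof (intro notI, elim conjE)
        assume "b \<in> proj p Q" "sinv (S p) b \<in> proj p Q"
        then obtain r s where "r \<in> Q" "s \<in> Q" "r p = b" "s p = sinv (S p) b"
          unfolding proj_def by auto
        then have "sle (S p) (sinv (S p) (r p)) (s p)" using lev.refl bS by simp
        then show False using sep \<open>r \<in> Q\<close> \<open>s \<in> Q\<close> by blast
      qed
      ultimately show ?thesis by blast
    qed
  qed
qed

text \<open>A core \<open>{a}\<close> at level \<open>p\<close> means that some element of \<sigma>
  is above all of \<sigma> there. If every level had such an element, a limit point of them would be
  in \<open>Q\<close> and above \<sigma>, and by maximality \<sigma> would be a singleton.\<close>

lemma evtl_core_not_singleton:
  assumes ns: "\<And>x. \<sigma> \<noteq> {x}"
  shows "evtl (\<lambda>p. \<not> (\<exists>a. core (S p) (proj p \<sigma>) = {a}))"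
proof -
  define R where "R = (\<lambda>p. {t \<in> \<sigma>. \<forall>y\<in>\<sigma>. sle (S p) (y p) (t p)})"
  have anti: "R q \<subseteq> R p" if "p \<le> q" for p q
    using le_below[OF _ that] \<sigma>_sub(2) unfolding R_def by blast
  have "(\<forall>p. R p \<noteq> {}) \<or> evtl (\<lambda>p. \<not> R p \<noteq> {})"
    using anti by (intro all_or_evtl_not) blast
  moreover have False if ne: "\<forall>p. R p \<noteq> {}"
  proof -
    have "\<exists>x\<in>seps L. \<forall>p. \<exists>y\<in>R p. y p = x p"
      using \<sigma>_sub(2) anti ne by (intro limit_point) (auto simp: R_def)
    then obtain x where x: "x \<in> seps L" "\<forall>p. \<exists>y\<in>R p. y p = x p" by blast
    then have "adherent \<sigma> x" unfolding adherent_def R_def by blast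
    then have "x \<in> Q" by (rule adherent_\<sigma>)
    have "y = x" if "y \<in> \<sigma>" for y
    proof -
      have "sle (S p) (y p) (x p)" for p
        using spec[OF x(2), of p] that by (auto simp: R_def)
      then show ?thesis using \<sigma>_maximal[OF that \<open>x \<in> Q\<close>] by (simp add: le_limit)
    qed
    moreover have "\<sigma> \<noteq> {}" using ne by (auto simp: R_def)
    ultimately show False using ns[of x] by blast
  qed
  ultimately have "evtl (\<lambda>p. \<not> R p \<noteq> {})" by blast
  then show ?thesis
  proof (rule evtl_mono, intro notI, elim exE)
    fix p a
    assume "\<not> R p \<noteq> {}" and a: "core (S p) (proj p \<sigma>) = {a}"
    obtain t where t: "t \<in> \<sigma>" "t p = a"
      using lev.core_subset[of p "proj p \<sigma>"] a by (auto simp: proj_def)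
    have "sle (S p) (y p) (t p)" if "y \<in> \<sigma>" for y
    proof -
      have "y p \<in> proj p \<sigma>" using that by (auto simp: proj_def)
      then show ?thesis
        using lev.ex_core_above[OF star_proj[OF \<sigma>_star] finite_proj[OF \<sigma>_sub(2)]] a t by fastforce
    qed
    then show False using t \<open>\<not> R p \<noteq> {}\<close> unfolding R_def by blast
  qed
qed

lemma mem_F: "\<sigma> \<in> F"
proof (cases "\<exists>x. \<sigma> = {x}")
  case True
  then obtain x where x: "\<sigma> = {x}" by blast
  then have xL: "x \<in> seps L" using \<sigma>_sub by blast
  then have c: "core (S p) (proj p \<sigma>) = {x p}" for p by (simp add: x proj_def)
  show ?thesis unfolding x
  proof (rule singleton_mem[OF xL evtl_mono[OF evtl_level_F]])
    fix p
    assume "\<exists>\<rho>\<in>level_F S f F p. core (S p) (proj p \<sigma>) = core (S p) \<rho> \<or>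
     (\<exists>s\<in>seps (S p). core (S p) (proj p \<sigma>) = {s} \<and> core (S p) \<rho> = {s, sinv (S p) s})"
    then show "\<exists>\<rho>\<in>level_F S f F p. core (S p) \<rho> = {x p} \<or> core (S p) \<rho> = {x p, sinv (S p) (x p)}"
      unfolding c by auto
  qed
next
  case False
  \<comment> \<open>A core that is not a singleton excludes both the stars in \<open>level_L\<close>
    and the alternative with two opposite orientations.\<close>
  have good: "evtl (\<lambda>p. \<exists>\<sigma>'\<in>F. core (S p) (proj p \<sigma>') = core (S p) (proj p \<sigma>))"
  proof (rule evtl_mono[OF evtl_conj[OF evtl_level_F evtl_core_not_singleton]])
    fix p
    assume "(\<exists>\<rho>\<in>level_F S f F p. core (S p) (proj p \<sigma>) = core (S p) \<rho> \<or>
     (\<exists>s\<in>seps (S p). core (S p) (proj p \<sigma>) = {s} \<and> core (S p) \<rho> = {s, sinv (S p) s})) \<and>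
     \<not> (\<exists>a. core (S p) (proj p \<sigma>) = {a})"
    then obtain \<rho> where \<rho>: "\<rho> \<in> level_F S f F p" "core (S p) (proj p \<sigma>) = core (S p) \<rho>"
      "\<not> (\<exists>a. core (S p) \<rho> = {a})" by metis
    then have "\<rho> \<notin> level_L S f p" unfolding level_L_def by blast
    then show "\<exists>\<sigma>'\<in>F. core (S p) (proj p \<sigma>') = core (S p) (proj p \<sigma>)"
      using \<rho> unfolding level_F_def by auto
  qed (use False in blast)
  have "\<exists>\<sigma>'\<in>F. core (S p) (proj p \<sigma>') = core (S p) (proj p \<sigma>)" for p
  proof (cases "\<exists>x\<in>\<sigma>. sle (S p) (sinv (S p) (x p)) (x p)")
    case False
    obtain q \<sigma>' where q: "p \<le> q" and \<sigma>': "\<sigma>' \<in> F" "core (S q) (proj q \<sigma>') = core (S q) (proj q \<sigma>)"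
      using evtl_above[OF good] by blast
    interpret separation_hom "S q" "S p" "bond q p"
      using bond_hom q by simp
    have nc: "\<not> sle (S p) (sinv (S p) (bond q p c)) (bond q p c)" if "c \<in> core (S q) (proj q \<sigma>)" for c
    proof -
      have "bond q p c \<in> proj p \<sigma>"
        using that lev.core_subset proj_bond[OF q \<sigma>_sub(2)] by blast
      then show ?thesis using False by (auto simp: proj_def)
    qed
    have "core (S p) (proj p \<sigma>) = maximal_elements (S p) (bond q p ` core (S q) (proj q \<sigma>))"
      using core_image_without_cosmall[OF star_proj[OF \<sigma>_star] finite_proj[OF \<sigma>_sub(2)] nc]
      by (simp add: proj_bond[OF q \<sigma>_sub(2)])
    moreover have "core (S p) (proj p \<sigma>') = maximal_elements (S p) (bond q p ` core (S q) (proj q \<sigma>'))"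
      using core_image_without_cosmall[OF star_proj[OF stars[OF \<sigma>'(1)]] finite_proj[OF F_sub[OF \<sigma>'(1)]]] nc
      by (simp add: proj_bond[OF q F_sub[OF \<sigma>'(1)]] \<sigma>'(2))
    ultimately show ?thesis using \<sigma>' by auto
  next
    case True
    then obtain x where x: "x \<in> \<sigma>" "sle (S p) (sinv (S p) (x p)) (x p)" by blast
    have xL: "x \<in> seps L" using x \<sigma>_sub by blast
    define z where "z = x p"
    have z: "z \<in> seps (S p)" "sle (S p) (sinv (S p) z) z" "z \<in> proj p \<sigma>"
      using x xL by (auto simp: z_def proj_def)
    have core\<sigma>: "core (S p) (proj p \<sigma>) = insert z ({sinv (S p) z} \<inter> proj p \<sigma>)"
      using lev.core_with_cosmall[OF star_proj[OF \<sigma>_star] z(3,2)] .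
    \<comment> \<open>The co-small element \<open>z\<close> comes from the common core at level
      \<open>q\<close>, so the two cores at level \<open>p\<close> can differ only in the inverse of
      \<open>z\<close>.\<close>
    have up: "z \<in> proj p \<sigma>' \<and> core (S p) (proj p \<sigma>') = insert z ({sinv (S p) z} \<inter> proj p \<sigma>')"
      if q: "p \<le> q" and \<sigma>': "\<sigma>' \<in> F" "core (S q) (proj q \<sigma>') = core (S q) (proj q \<sigma>)" for q \<sigma>'
    proof -
      interpret separation_hom "S q" "S p" "bond q p"
        using bond_hom q by simp
      have "x q \<in> proj q \<sigma>" "bond q p (x q) = z"
        using x(1) bond_limit[OF xL q] by (auto simp: proj_def z_def)
      then obtain c where "c \<in> core (S q) (proj q \<sigma>)" "bond q p c = z"
        using cosmall_image_core[OF star_proj[OF \<sigma>_star] finite_proj[OF \<sigma>_sub(2)], of "x q"] z(2) by auto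
      then have "z \<in> proj p \<sigma>'"
        using \<sigma>'(2) lev.core_subset proj_bond[OF q F_sub[OF \<sigma>'(1)]] by blast
      then show ?thesis
        using lev.core_with_cosmall[OF star_proj[OF stars[OF \<sigma>'(1)]] _ z(2)] by blast
    qed
    \<comment> \<open>The star inequality between \<open>u\<close> and \<open>x\<close> bounds
      \<open>u p\<close> from above by the inverse of \<open>z\<close>, and \<open>y\<close> bounds
      it from below.\<close>
    have other: "u p = sinv (S p) z"
      if u: "u \<in> \<sigma>" "u \<noteq> x" and y: "y \<in> seps L" "y p = sinv (S p) z" "sle (S p) (y p) (u p)" for u y
    proof -
      have "sle (S p) (u p) (sinv (S p) z)"
        using lim.starD[OF \<sigma>_star u(1) x(1) u(2)] by (simp add: le_limit z_def)
      then show ?thesis using y(2,3) lev.antisym u(1) \<sigma>_sub(2) z by (metis lev.inv_closed limit_apply subsetD)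
    qed
    show ?thesis
    proof (cases "sinv (S p) z = z \<or> sinv (S p) z \<in> proj p \<sigma>")
      case True
      show ?thesis
      proof (cases "sinv (S p) z = z")
        case True
        obtain q \<sigma>' where "p \<le> q" "\<sigma>' \<in> F" "core (S q) (proj q \<sigma>') = core (S q) (proj q \<sigma>)"
          using evtl_above[OF good] by blast
        then show ?thesis using up[of q \<sigma>'] core\<sigma> True by auto
      next
        case False
        then obtain y where y: "y \<in> \<sigma>" "y p = sinv (S p) z"
          using True by (auto simp: proj_def)
        then have "y \<noteq> x" using False z_def by metis
        have yL: "y \<in> seps L" using y \<sigma>_sub by blast
        \<comment> \<open>Choosing \<open>q\<close> so large that \<open>y q\<close> is not below
          \<open>x q\<close> ensures that the core element above \<open>y q\<close> comes from some
          \<open>u\<close> other than \<open>x\<close>; this \<open>u\<close> carries the inverse of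
          \<open>z\<close> into the projection of \<open>\<sigma>'\<close>.\<close>
        have "\<not> sle L y x" using \<sigma>_maximal[OF y(1)] x(1) \<sigma>_sub(1) \<open>y \<noteq> x\<close> by blast
        then obtain q \<sigma>' where q: "p \<le> q" "\<not> sle (S q) (y q) (x q)"
          and \<sigma>': "\<sigma>' \<in> F" "core (S q) (proj q \<sigma>') = core (S q) (proj q \<sigma>)"
          using evtl_above[OF evtl_conj[OF good evtl_not_le[OF _ yL xL]]] by blast
        obtain c where c: "c \<in> core (S q) (proj q \<sigma>)" "sle (S q) (y q) c"
          using lev.ex_core_above[OF star_proj[OF \<sigma>_star] finite_proj[OF \<sigma>_sub(2)], of "y q"] y(1)
          by (auto simp: proj_def)
        then obtain u where u: "u \<in> \<sigma>" "u q = c"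
          using lev.core_subset[of q "proj q \<sigma>"] by (auto simp: proj_def)
        have uL: "u \<in> seps L" "u \<noteq> x" using u \<sigma>_sub c q by auto
        have "u p = sinv (S p) z"
          using other[OF u(1) uL(2) yL y(2)] le_below[OF _ q(1) yL uL(1)] c u by blast
        moreover have "u p \<in> proj p \<sigma>'"
        proof -
          have "u q \<in> proj q \<sigma>'" using c u \<sigma>'(2) lev.core_subset by blast
          then have "bond q p (u q) \<in> proj p \<sigma>'" using proj_bond[OF q(1) F_sub[OF \<sigma>'(1)]] by blast
          then show ?thesis using bond_limit[OF uL(1) q(1)] by simp
        qed
        ultimately show ?thesis using up[OF q(1) \<sigma>'] core\<sigma> True \<sigma>'(1) by auto
      qed
    next
      case False
      then have nz: "sinv (S p) z \<noteq> z" "sinv (S p) z \<notin> proj p \<sigma>" by auto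
      then have core1: "core (S p) (proj p \<sigma>) = {z}" using core\<sigma> by blast
      show ?thesis
      proof (rule ccontr)
        assume none: "\<not> ?thesis"
        \<comment> \<open>Approximations at level \<open>q\<close> to a trivial element witnessed by
          \<open>x\<close>, all projecting to the inverse of \<open>z\<close> at level
          \<open>p\<close>.\<close>
        define R where "R = (\<lambda>q. {y \<in> seps L. sle (S q) (y q) (x q) \<and> sle (S q) (y q) (sinv L x q) \<and>
          y p = sinv (S p) z})"
        have anti: "R q \<subseteq> R r" if "r \<le> q" for r q
          using le_below[OF _ that] xL lim.inv_closed unfolding R_def by blast
        have ne: "R q \<noteq> {}" if q: "p \<le> q"
          and \<sigma>': "\<sigma>' \<in> F" "core (S q) (proj q \<sigma>') = core (S q) (proj q \<sigma>)" for q \<sigma>'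
        proof -
          \<comment> \<open>If it were missing, the core of the projection of
            \<open>\<sigma>'\<close> would be \<open>{z}\<close>, and \<open>\<sigma>'\<close> would
            be the member of \<open>F\<close> assumed not to exist.\<close>
          have "sinv (S p) z \<in> proj p \<sigma>'" using up[OF q \<sigma>'] none \<sigma>'(1) core1 by auto
          then obtain y where y: "y \<in> \<sigma>'" "y p = sinv (S p) z" by (auto simp: proj_def)
          have yL: "y \<in> seps L" using y F_sub \<sigma>' by blast
          have st': "star (S q) (proj q \<sigma>')" "finite (proj q \<sigma>')"
            using star_proj stars finite_proj F_sub \<sigma>' by auto
          have yq: "y q \<in> proj q \<sigma>'" using y by (auto simp: proj_def)
          then obtain c where c: "c \<in> core (S q) (proj q \<sigma>')" "sle (S q) (y q) c"
            using lev.ex_core_above[OF st'] by blast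
          then obtain u where u: "u \<in> \<sigma>" "u q = c"
            using lev.core_subset[of q "proj q \<sigma>"] \<sigma>'(2) by (auto simp: proj_def)
          have uL: "u \<in> seps L" using u \<sigma>_sub by blast
          have "u = x"
          proof (rule ccontr)
            assume "u \<noteq> x"
            then have "u p = sinv (S p) z"
              using other[OF u(1) _ yL y(2)] le_below[OF _ q yL uL] c u by blast
            then show False using nz u(1) by (metis imageI proj_def)
          qed
          then have xc: "x q \<in> proj q \<sigma>'" "sle (S q) (y q) (x q)"
            using c u lev.core_subset by auto
          have "y q \<noteq> x q" using eq_below[of y q x p] q yL xL y(2) nz by (metis z_def)
          then have "sle (S q) (y q) (sinv L x q)"
            using lev.starD[OF st'(1) yq xc(1)] by simp
          then show ?thesis using xc yL y(2) unfolding R_def by blast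
        qed
        have "\<exists>y\<in>seps L. \<forall>q. \<exists>y'\<in>R q. y' q = y q"
        proof (rule limit_point)
          show "R q \<subseteq> seps L" for q by (auto simp: R_def)
          show "R q \<noteq> {}" for q
          proof -
            obtain r where r: "p \<le> r" "q \<le> r" using directed by blast
            obtain r' \<sigma>' where r': "r \<le> r'" "\<sigma>' \<in> F" "core (S r') (proj r' \<sigma>') = core (S r') (proj r' \<sigma>)"
              using evtl_above[OF good] by blast
            then have "R r' \<noteq> {}" using ne[of r' \<sigma>'] r by auto
            then show ?thesis using anti[of q r'] r r' by auto
          qed
        qed (rule anti)
        then obtain y where y: "y \<in> seps L" and *: "\<forall>q. \<exists>y'\<in>R q. y' q = y q" by blast
        have le: "sle (S q) (y q) (x q) \<and> sle (S q) (y q) (sinv L x q)" for q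
          using spec[OF *, of q] by (auto simp: R_def)
        have yp: "y p = sinv (S p) z" using spec[OF *, of p] by (auto simp: R_def)
        have leL: "sle L y x" "sle L y (sinv L x)" using le unfolding le_limit by auto
        \<comment> \<open>Both orientations of \<open>y\<close> must differ from \<open>x\<close>
          for \<open>x\<close> to witness triviality: \<open>x = y\<close> fails at level
          \<open>p\<close>, and \<open>x\<close> being the inverse of \<open>y\<close> would make
          \<open>x\<close> co-small.\<close>
        have "x \<noteq> y" using yp nz by (auto simp: z_def)
        moreover have "x \<noteq> sinv L y"
        proof
          assume "x = sinv L y"
          then have "y = sinv L x" using y by simp
          then show False using leL not_cosmall x by blast
        qed
        ultimately have "finitely_trivial S f y"
          using finitely_trivialI[OF y xL] leL by blast
        then have "{sinv L y} \<in> F" by (rule finitely_trivial_mem)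
        moreover have "proj p {sinv L y} = {z}" using yp z by (simp add: proj_def)
        then have "core (S p) (proj p {sinv L y}) = {z}" using z by simp
        ultimately show False using none core1 by auto
      qed
    qed
  qed
  then show ?thesis using closed_coreI[OF \<sigma>_sub(2)] by blast
qed

end

context compatible_families
begin

lemma T_over: "over L T F"
  unfolding over_def T_splits
proof (intro allI impI, elim exE)
  fix \<sigma> Q
  assume sp: "lim.splits T Q \<sigma>"
  show "\<sigma> \<in> F"
  proof (cases "\<exists>x\<in>\<sigma>. sle L (sinv L x) x")
    case True
    then show ?thesis using cosmall_split_mem[OF sp] by blast
  next
    case False
    then interpret split_without_cosmall S f F N Q \<sigma>
      using sp by unfold_locales auto
    show ?thesis by (rule mem_F)
  qed
qed

end

theorem theorem6p6:
  fixes S :: "'p::order \<Rightarrow> 'a sepsys"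
    and f :: "'p \<Rightarrow> 'p \<Rightarrow> 'a \<Rightarrow> 'a"
    and F :: "('p \<Rightarrow> 'a) set set"
  assumes directed: "\<And>p q :: 'p. \<exists>r. p \<le> r \<and> q \<le> r"
    and inverse_system: "inverse_system S f"
    and finite: "\<And>p. finite (seps (S p))"
    and no_degenerate: "\<And>s. s \<in> seps (inv_limit S f) \<Longrightarrow> \<not> degenerate (inv_limit S f) s"
    and stars: "\<And>\<sigma>. \<sigma> \<in> F \<Longrightarrow> star (inv_limit S f) \<sigma>"
    and closed: "essentially_closed S f F"
    and levels: "\<And>p. \<exists>\<tau>\<^sub>p. \<tau>\<^sub>p \<subseteq> seps (S p) \<and> nested (S p) \<tau>\<^sub>p \<and>
                       essentially_over (S p) \<tau>\<^sub>p (level_F S f F p)"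
  shows "\<exists>\<tau>. \<tau> \<subseteq> seps (inv_limit S f) \<and> nested (inv_limit S f) \<tau> \<and>
             closedin (limit_topology S f) \<tau> \<and> over (inv_limit S f) \<tau> F"
proof -
  interpret separation_inverse_system S f
    using directed inverse_system finite by unfold_locales
  interpret star_family S f F
    using no_degenerate stars closed by unfold_locales (metis degenerate_def)+
  obtain N where N: "\<And>p. lev.sym_subset p (N p)" "\<And>p. nested (S p) (N p)"
    "\<And>p q. p < q \<Longrightarrow> f q p ` N q = N p"
    "evtl (\<lambda>p. (\<forall>a\<in>seps (S p). sinv (S p) a \<noteq> a) \<and> essentially_over (S p) (N p) (level_F S f F p))"
    using ex_compatible_families[OF levels] by blast
  interpret compatible_families S f F N
    using N by unfold_locales
  show ?thesis
    using T_sub T_nested T_closed T_over by blast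
qed

end
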